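(* Let $m$ be a positive integer and $k$ a nonnegative integer. Then there are natural isomorphisms of $\mathbb{L}$-species $$L_k\mathcal{S}^m\cong \mathsf{E}_k\circ \mathsf{L}_+^{\circ m}\qquad\text{and}\qquad L\mathcal{S}^m\cong \mathsf{E}\circ\mathsf{L}_+^{\circ m}.$$
   Context: A species is a functor from the category $\mathbb{B}$ of finite sets and bijections to the category $\mathbb{E}$ of finite sets and maps. An $\mathbb{L}$-species is a functor $\mathsf{F}:\mathbb{L}\to\mathbb{E}$, where $\mathbb{L}$ is the category of linearly ordered finite sets and order-preserving bijections; $\mathsf{F}[n]:=\mathsf{F}[\{1,\dots,n\}]$ with the usual order. Every species is regarded as an $\mathbb{L}$-species via the forgetful functor $\mathbb{L}\to\mathbb{B}$. In the paper, $\mathsf{F}=\mathsf{G}$ means that there is a natural isomorphism. All species below act on morphisms by the evident relabelling. Basic species: $\mathsf{E}$ (sets) is $\mathsf{E}[V]=\{V\}$; $\mathsf{L}$ (lists) is $\mathsf{L}[V]=\{(v_1,\dots,v_n): n=|V|,\ V=\{v_1,\dots,v_n\}\}$. For a species $\mathsf{F}$ and $k\ge 0$, $\mathsf{F}_k[V]=\mathsf{F}[V]$ if $|V|=k$ and $\varnothing$ otherwise; $\mathsf{F}_+[\varnothing]=\varnothing$ and $\mathsf{F}_+[V]=\mathsf{F}[V]$ for $V\neq\varnothing$. Substitution: if $\mathsf{G}[\varnothing]=\varnothing$, then $(\mathsf{F}\circ\mathsf{G})[V]=\bigsqcup_{\pi}\bigl(\mathsf{F}[\pi]\times\prod_{B\in\pi}\mathsf{G}[B]\bigr)$,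 where $\pi$ runs over all set partitions of $V$ (into nonempty blocks; $\varnothing$ has exactly one set partition, the empty one). $\mathsf{L}_+^{\circ m}$ is the $m$-fold iterated substitution $\mathsf{L}_+\circ\cdots\circ\mathsf{L}_+$. Arrangements: for a finite linearly ordered set $V$ and $m\ge 1$, the extended Shi arrangement in $\mathbb{R}^V$ is the set of hyperplanes $\{x_u-x_v=a\}$ with $u<v$ in $V$ and $a$ an integer, $1-m\le a\le m$; for $V=\{1,\dots,n\}$ it is $\mathcal{S}^m_n=\{\{x_i-x_j=a\}:1\le i<j\le n,\ a\in\mathbb{Z},\ 1-m\le a\le m\}$ in $\mathbb{R}^n$. A flat of an arrangement $\mathcal{A}$ is a nonempty intersection of hyperplanes of $\mathcal{A}$ (including the ambient space as the empty intersection); $L(\mathcal{A})$ is the set of flats and $L_k(\mathcal{A})$ the set of flats of dimension $k$. $L\mathcal{S}^m$ (resp. $L_k\mathcal{S}^m$) is the $\mathbb{L}$-species sending $V$ to the set of flats (resp. $k$-dimensional flats) of the extended Shi arrangement in $\mathbb{R}^V$, so $L\mathcal{S}^m[n]=L(\mathcal{S}^m_n)$ and $L_k\mathcal{S}^m[n]=L_k(\mathcal{S}^m_n)$. *)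

theory Defs
  imports "HOL-Analysis.Analysis" "HOL-Analysis.Finite_Function_Topology"
    "HOL-Library.FSet" "HOL-Library.Disjoint_Sets"
begin

section \<open>A universe of labels and structures\<close>

text \<open>
  In \<open>F \<circ> G\<close> the species \<open>F\<close> is evaluated at a set partition, whose elements are themselves sets
  of labels, and the structures of an iterated substitution are nested to arbitrary depth. To have
  a single type for all of these, finite sets are taken to be the finite subsets of the type below,
  which contains all hereditarily finite sets, pairs and lists over the atoms \<open>'a\<close>.
\<close>

datatype 'a univ =
    Atom 'a
  | USet "'a univ fset"
  | UPair "'a univ" "'a univ"
  | UList "'a univ list"

text \<open>Only used for finite \<open>A\<close>.\<close>

definition uset :: "'a univ set \<Rightarrow> 'a univ"
  where "uset A = USet (Abs_fset A)"

definition elems :: "'a univ \<Rightarrow> 'a univ set"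
  where "elems s = (case s of USet A \<Rightarrow> fset A)"

definition uimage :: "('a univ \<Rightarrow> 'a univ) \<Rightarrow> 'a univ \<Rightarrow> 'a univ"
  where "uimage f s = uset (f ` elems s)"

text \<open>The family \<open>(h B)\<^sub>B\<close>, \<open>B \<in> P\<close>, as an element of the universe, namely as its graph.\<close>

definition ufamily :: "'a univ set set \<Rightarrow> ('a univ set \<Rightarrow> 'a univ) \<Rightarrow> 'a univ"
  where "ufamily P h = uset ((\<lambda>B. UPair (uset B) (h B)) ` P)"


section \<open>Species and L-species\<close>

text \<open>
  A bijection \<open>\<sigma> : V \<rightarrow> W\<close> is given by \<open>V\<close> and a function \<open>\<sigma>\<close> injective on \<open>V\<close>; its codomain is
  \<open>W = \<sigma> ` V\<close>. In \<open>relabel F V \<sigma>\<close> only the values of \<open>\<sigma>\<close> on \<open>V\<close> may matter.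
\<close>

record ('a, 'b) species =
  str :: "'a set \<Rightarrow> 'b set"
  relabel :: "'a set \<Rightarrow> ('a \<Rightarrow> 'a) \<Rightarrow> 'b \<Rightarrow> 'b"

text \<open>
  An object of the category of finite linear orders is a finite set \<open>V\<close> with a linear order
  \<open>r \<subseteq> V \<times> V\<close> (reflexive, so \<open>(u, v) \<in> r\<close> reads \<open>u \<le> v\<close>).
\<close>

definition fin_linorder :: "'a set \<Rightarrow> 'a rel \<Rightarrow> bool"
  where "fin_linorder V r \<longleftrightarrow> finite V \<and> linear_order_on V r"

definition order_bij :: "'a set \<Rightarrow> 'a rel \<Rightarrow> 'a set \<Rightarrow> 'a rel \<Rightarrow> ('a \<Rightarrow> 'a) \<Rightarrow> bool"
  where "order_bij V r W s \<sigma> \<longleftrightarrow>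
    fin_linorder V r \<and> fin_linorder W s \<and> bij_betw \<sigma> V W \<and>
    (\<forall>u\<in>V. \<forall>v\<in>V. (u, v) \<in> r \<longrightarrow> (\<sigma> u, \<sigma> v) \<in> s)"

record ('a, 'b) lspecies =
  lstr :: "'a set \<Rightarrow> 'a rel \<Rightarrow> 'b set"
  lrelabel :: "'a set \<Rightarrow> 'a rel \<Rightarrow> ('a \<Rightarrow> 'a) \<Rightarrow> 'b \<Rightarrow> 'b"

text \<open>
  \<open>F\<close> is a functor to finite sets and maps; the third condition says that the action depends only
  on the morphism, that is, on the restriction of \<open>\<sigma>\<close> to \<open>V\<close>.
\<close>

definition is_lspecies :: "('a, 'b) lspecies \<Rightarrow> bool"
  where "is_lspecies F \<longleftrightarrow>
    (\<forall>V r. fin_linorder V r \<longrightarrow> finite (lstr F V r)) \<and>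
    (\<forall>V r W s \<sigma>. order_bij V r W s \<sigma> \<longrightarrow> lrelabel F V r \<sigma> \<in> lstr F V r \<rightarrow> lstr F W s) \<and>
    (\<forall>V r W s \<sigma> \<tau>. order_bij V r W s \<sigma> \<and> (\<forall>v\<in>V. \<sigma> v = \<tau> v) \<longrightarrow>
      (\<forall>x\<in>lstr F V r. lrelabel F V r \<sigma> x = lrelabel F V r \<tau> x)) \<and>
    (\<forall>V r. fin_linorder V r \<longrightarrow> (\<forall>x\<in>lstr F V r. lrelabel F V r id x = x)) \<and>
    (\<forall>V r W s X t \<sigma> \<tau>. order_bij V r W s \<sigma> \<and> order_bij W s X t \<tau> \<longrightarrow>
      (\<forall>x\<in>lstr F V r. lrelabel F V r (\<tau> \<circ> \<sigma>) x = lrelabel F W s \<tau> (lrelabel F V r \<sigma> x)))"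

definition lspecies_iso :: "('a, 'b) lspecies \<Rightarrow> ('a, 'c) lspecies \<Rightarrow> bool"  (infix "\<cong>\<^sub>L" 50)
  where "F \<cong>\<^sub>L G \<longleftrightarrow>
    is_lspecies F \<and> is_lspecies G \<and>
    (\<exists>\<eta>. (\<forall>V r. fin_linorder V r \<longrightarrow> bij_betw (\<eta> V r) (lstr F V r) (lstr G V r)) \<and>
         (\<forall>V r W s \<sigma>. order_bij V r W s \<sigma> \<longrightarrow>
            (\<forall>x\<in>lstr F V r. \<eta> W s (lrelabel F V r \<sigma> x) = lrelabel G V r \<sigma> (\<eta> V r x))))"

definition forget_order :: "('a, 'b) species \<Rightarrow> ('a, 'b) lspecies"
  where "forget_order F = \<lparr>lstr = (\<lambda>V r. str F V), lrelabel = (\<lambda>V r. relabel F V)\<rparr>"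


section \<open>Basic species and substitution\<close>

definition set_species :: "('a univ, 'a univ) species"  ("\<E>")
  where "\<E> = \<lparr>str = (\<lambda>V. {uset V}), relabel = (\<lambda>V \<sigma>. uimage \<sigma>)\<rparr>"

definition list_species :: "('a univ, 'a univ) species"  ("\<L>")
  where "\<L> = \<lparr>
    str = (\<lambda>V. {UList xs | xs. length xs = card V \<and> set xs = V}),
    relabel = (\<lambda>V \<sigma> s. case s of UList xs \<Rightarrow> UList (map \<sigma> xs))\<rparr>"

definition restrict_card :: "('a, 'b) species \<Rightarrow> nat \<Rightarrow> ('a, 'b) species"
  where "restrict_card F k =
    \<lparr>str = (\<lambda>V. if card V = k then str F V else {}), relabel = relabel F\<rparr>"

definition nonempty_part :: "('a, 'b) species \<Rightarrow> ('a, 'b) species"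
  where "nonempty_part F =
    \<lparr>str = (\<lambda>V. if V = {} then {} else str F V), relabel = relabel F\<rparr>"

text \<open>
  A structure of \<open>F \<circ> G\<close> on \<open>V\<close> is a triple of a partition \<open>P\<close>, an \<open>F\<close>-structure on the set of
  blocks (each block \<open>B\<close> being the label \<open>uset B\<close>) and a family of \<open>G\<close>-structures on the blocks.
  A bijection \<open>\<sigma>\<close> induces the bijection \<open>uimage \<sigma>\<close> between the sets of blocks. As
  \<open>{} \<notin> P\<close>, the values of \<open>G\<close> on the empty set are never used.
\<close>

definition subst_species ::
    "('a univ, 'a univ) species \<Rightarrow> ('a univ, 'a univ) species \<Rightarrow> ('a univ, 'a univ) species"
    (infixr "\<odot>" 75)
  where "F \<odot> G = \<lparr>
    str = (\<lambda>V. {UPair (uset (uset ` P)) (UPair f (ufamily P h)) | P f h.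
      partition_on V P \<and> f \<in> str F (uset ` P) \<and> h \<in> (\<Pi>\<^sub>E B\<in>P. str G B)}),
    relabel = (\<lambda>V \<sigma> s. case s of UPair p (UPair f g) \<Rightarrow>
      UPair (uimage (uimage \<sigma>) p)
        (UPair (relabel F (elems p) (uimage \<sigma>) f)
          (uimage (\<lambda>e. case e of UPair B y \<Rightarrow>
             UPair (uimage \<sigma> B) (relabel G (elems B) \<sigma> y)) g)))\<rparr>"

text \<open>\<open>G \<odot> (G \<odot> (\<dots> \<odot> G))\<close> with \<open>m \<ge> 1\<close> factors; only used for \<open>m \<ge> 1\<close>.\<close>

definition iterated_subst ::
    "('a univ, 'a univ) species \<Rightarrow> nat \<Rightarrow> ('a univ, 'a univ) species"
  where "iterated_subst G m = (((\<odot>) G) ^^ (m - 1)) G"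


section \<open>Extended Shi arrangements and their flats\<close>

text \<open>
  For finite \<open>V\<close>, the space \<open>\<real>\<^sup>V\<close> is the subspace of the real vector space of finitely supported
  functions consisting of those supported in \<open>V\<close>.
\<close>

definition coord_space :: "'a set \<Rightarrow> ('a \<Rightarrow>\<^sub>0 real) set"
  where "coord_space V = {x. Poly_Mapping.keys x \<subseteq> V}"

definition shi_arrangement :: "nat \<Rightarrow> 'a set \<Rightarrow> 'a rel \<Rightarrow> ('a \<Rightarrow>\<^sub>0 real) set set"
  where "shi_arrangement m V r =
    {{x \<in> coord_space V. Poly_Mapping.lookup x u - Poly_Mapping.lookup x v = of_int a} | u v a.
      u \<in> V \<and> v \<in> V \<and> u \<noteq> v \<and> (u, v) \<in> r \<and> 1 - int m \<le> a \<and> a \<le> int m}"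

definition flats :: "'a set \<Rightarrow> ('a \<Rightarrow>\<^sub>0 real) set set \<Rightarrow> ('a \<Rightarrow>\<^sub>0 real) set set"
  where "flats V \<A> = {X. X \<noteq> {} \<and> (\<exists>\<H>\<subseteq>\<A>. X = coord_space V \<inter> \<Inter>\<H>)}"

text \<open>
  The dimension of an affine subspace is that of its space of directions. (The library's
  \<open>aff_dim\<close> is only available in types of fixed finite dimension.)
\<close>

definition flat_dim :: "('a \<Rightarrow>\<^sub>0 real) set \<Rightarrow> nat"
  where "flat_dim X = dim {x - y | x y. x \<in> X \<and> y \<in> X}"

text \<open>The image of \<open>X \<subseteq> \<real>\<^sup>V\<close> under the isomorphism \<open>\<real>\<^sup>V \<rightarrow> \<real>\<^bsup>\<sigma> ` V\<^esup>\<close> renaming the coordinates.\<close>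

definition relabel_flat ::
    "'a set \<Rightarrow> ('a \<Rightarrow> 'a) \<Rightarrow> ('a \<Rightarrow>\<^sub>0 real) set \<Rightarrow> ('a \<Rightarrow>\<^sub>0 real) set"
  where "relabel_flat V \<sigma> X =
    {y \<in> coord_space (\<sigma> ` V).
      \<exists>x\<in>X. \<forall>v\<in>V. Poly_Mapping.lookup y (\<sigma> v) = Poly_Mapping.lookup x v}"

definition shi_flats :: "nat \<Rightarrow> ('a, ('a \<Rightarrow>\<^sub>0 real) set) lspecies"
  where "shi_flats m = \<lparr>
    lstr = (\<lambda>V r. flats V (shi_arrangement m V r)),
    lrelabel = (\<lambda>V r. relabel_flat V)\<rparr>"

definition shi_flats_dim :: "nat \<Rightarrow> nat \<Rightarrow> ('a, ('a \<Rightarrow>\<^sub>0 real) set) lspecies"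
  where "shi_flats_dim m k = \<lparr>
    lstr = (\<lambda>V r. {X \<in> flats V (shi_arrangement m V r). flat_dim X = k}),
    lrelabel = (\<lambda>V r. relabel_flat V)\<rparr>"

end

theory Submission
  imports Defs "HOL-Combinatorics.Multiset_Permutations"
begin

text \<open>
  Both isomorphisms are statements about cardinalities. Between two finite linear orders of the
  same size there is exactly one morphism, so two L-species are naturally isomorphic as soon as
  they have equally many structures on every finite linear order
  (\<open>lspecies_iso_if_equinumerous\<close>). The two sides are therefore counted, and the counts agree
  because both sides split over set partitions of \<open>V\<close> with the same number of structures,
  \<open>n! m\<^bsup>n-1\<^esup>\<close>, on a block of size \<open>n\<close>.

  On the side of lists, the number \<open>n! m\<^bsup>n-1\<^esup>\<close> of \<open>m\<close>-fold nested lists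
  (\<open>card_iterated_lists\<close>) reflects that a nested list is a list in which each of the \<open>n - 1\<close> gaps
  carries one of \<open>m\<close> nesting levels. It is obtained by induction on \<open>m\<close> from
  \<open>L\<^sub>+(x / (1 - c x)) = x / (1 - (c + 1) x)\<close>, where \<open>L\<^sub>+(x) = x / (1 - x)\<close>, in the form of a
  recursion that splits off the first block of an ordered set partition.

  On the side of flats, a flat fixes the differences \<open>x\<^sub>u - x\<^sub>v\<close> of some coordinates, which are then
  integers. The pairs \<open>u, v\<close> with fixed difference are those in the same connected component of
  the graph formed by the hyperplanes containing the flat. So a flat is a partition of \<open>V\<close> together
  with, for every block, a placement of its elements at integer positions, up to translation, such
  that the graph joining \<open>u < v\<close> if \<open>1 - m \<le> x\<^sub>u - x\<^sub>v \<le> m\<close> is connected; its dimension is the number of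
  blocks (\<open>flat_of_in_flats\<close>, \<open>flat_of_inj\<close>, \<open>flats_eq_flat_of\<close>, \<open>flat_dim_flat_of\<close>).

  To count the connected placements of a block, sort its elements by position and, at equal
  positions, by increasing label. If two consecutive elements are not adjacent, then no edge passes
  over the gap between them, so a placement is connected if and only if consecutive elements are
  adjacent (\<open>connected_configs_eq_UN_chain_configs\<close>). The distance of consecutive elements \<open>u\<close>, \<open>v\<close>
  then ranges over \<open>0, \<dots>, m - 1\<close> if \<open>u < v\<close> and over \<open>1, \<dots>, m\<close> if \<open>u > v\<close>. In both cases there are \<open>m\<close>
  choices, which gives \<open>n! m\<^bsup>n-1\<^esup>\<close> (\<open>card_connected_configs\<close>).
\<close>


section \<open>Finite linear orders\<close>

lemma ex1_sorted_wrt: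
  assumes "finite A" "irreflp_on A R" "transp_on A R" "totalp_on A R"
  shows "\<exists>!xs. set xs = A \<and> sorted_wrt R xs"
proof (rule ex_ex1I)
  show "\<exists>xs. set xs = A \<and> sorted_wrt R xs"
    using assms
  proof (induction A rule: finite_remove_induct)
    case empty
    then show ?case by simp
  next
    case (remove A)
    have "asymp_on A R"
      using remove.prems by (auto intro!: asymp_onI dest: transp_onD irreflp_onD)
    then obtain a where a: "a \<in> A" "\<forall>b\<in>A. b \<noteq> a \<longrightarrow> \<not> R b a"
      using Finite_Set.bex_min_element[of A R] remove by blast
    have "irreflp_on (A - {a}) R" "transp_on (A - {a}) R" "totalp_on (A - {a}) R"
      using remove.prems
      by (auto intro: irreflp_on_subset transp_on_subset totalp_on_subset)
    from remove.IH[OF a(1) this] obtain xs where "set xs = A - {a}" "sorted_wrt R xs"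
      by blast
    moreover have "R a b" if "b \<in> A - {a}" for b
      using that a remove.prems(3) by (auto dest: totalp_onD)
    ultimately have "set (a # xs) = A \<and> sorted_wrt R (a # xs)"
      using a(1) by auto
    then show ?case by blast
  qed
next
  fix xs ys
  assume "set xs = A \<and> sorted_wrt R xs" "set ys = A \<and> sorted_wrt R ys"
  then show "xs = ys"
    using assms
  proof (induction xs arbitrary: ys A)
    case Nil
    then show ?case by auto
  next
    case (Cons a xs)
    then obtain b ys' where ys: "ys = b # ys'"
      by (cases ys) auto
    have irr: "\<not> R c c" if "c \<in> A" for c
      using Cons.prems(4) that by (rule irreflp_onD)
    have "a = b"
    proof (rule ccontr)
      assume "a \<noteq> b"
      then have "R a b" "R b a" "a \<in> A" "b \<in> A"
        using Cons.prems ys by auto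
      then show False
        using irr Cons.prems(5) by (meson transp_onD)
    qed
    moreover have "set xs = A - {a}" "set ys' = A - {a}"
      using Cons.prems(1,2) ys irr \<open>a = b\<close> by auto
    ultimately show ?case
      using Cons.IH[of "A - {a}" ys'] Cons.prems ys
      by (auto intro: irreflp_on_subset transp_on_subset totalp_on_subset)
  qed
qed

definition lt_of :: "'a rel \<Rightarrow> 'a \<Rightarrow> 'a \<Rightarrow> bool"
  where "lt_of r u v \<longleftrightarrow> (u, v) \<in> r \<and> u \<noteq> v"

lemma fin_linorder_lt_of:
  assumes "fin_linorder V r"
  shows "irreflp_on V (lt_of r)" "transp_on V (lt_of r)" "totalp_on V (lt_of r)"
  using assms unfolding fin_linorder_def order_on_defs lt_of_def
  by (auto intro!: irreflp_onI transp_onI totalp_onI dest: transD antisymD simp: total_on_def)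

text \<open>
  An order isomorphism maps the increasing list of its domain to that of its codomain, which shows
  both that it exists and that it is unique.
\<close>

definition increasing_list :: "'a set \<Rightarrow> 'a rel \<Rightarrow> 'a list"
  where "increasing_list V r = (THE xs. set xs = V \<and> sorted_wrt (lt_of r) xs)"

lemma increasing_list:
  assumes "fin_linorder V r"
  shows "set (increasing_list V r) = V" "sorted_wrt (lt_of r) (increasing_list V r)"
    and "distinct (increasing_list V r)" "length (increasing_list V r) = card V"
    and "\<And>xs. set xs = V \<Longrightarrow> sorted_wrt (lt_of r) xs \<Longrightarrow> xs = increasing_list V r"
proof -
  have ex1: "\<exists>!xs. set xs = V \<and> sorted_wrt (lt_of r) xs"
    using assms by (intro ex1_sorted_wrt fin_linorder_lt_of) (auto simp: fin_linorder_def)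
  from theI'[OF ex1] show *: "set (increasing_list V r) = V"
    "sorted_wrt (lt_of r) (increasing_list V r)"
    by (auto simp: increasing_list_def)
  show "distinct (increasing_list V r)"
    unfolding distinct_conv_nth using *(2)
    by (metis lt_of_def nat_neq_iff sorted_wrt_nth_less)
  then show "length (increasing_list V r) = card V"
    using * distinct_card by metis
  show "xs = increasing_list V r" if "set xs = V" "sorted_wrt (lt_of r) xs" for xs
    using ex1 * that by blast
qed

lemma order_bij_lt_of:
  assumes "order_bij V r W s \<sigma>" "u \<in> V" "v \<in> V"
  shows "lt_of s (\<sigma> u) (\<sigma> v) \<longleftrightarrow> lt_of r u v"
proof -
  have imp: "lt_of s (\<sigma> a) (\<sigma> b)" if "a \<in> V" "b \<in> V" "lt_of r a b" for a b
    using that assms(1) unfolding order_bij_def lt_of_def bij_betw_def inj_on_def by blast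
  have W: "\<sigma> u \<in> W" "\<sigma> v \<in> W"
    using assms by (auto simp: order_bij_def bij_betw_def)
  show ?thesis
  proof
    assume *: "lt_of s (\<sigma> u) (\<sigma> v)"
    show "lt_of r u v"
    proof (rule ccontr)
      assume "\<not> lt_of r u v"
      moreover have "u \<noteq> v" using * by (auto simp: lt_of_def)
      ultimately have "lt_of r v u"
        using assms fin_linorder_lt_of(3) by (metis order_bij_def totalp_onD)
      from imp[OF assms(3,2) this] * show False
        using assms W fin_linorder_lt_of(1,2) by (metis order_bij_def transp_onD irreflp_onD)
    qed
  qed (use imp assms in blast)
qed

lemma order_bij_increasing_list:
  assumes "order_bij V r W s \<sigma>"
  shows "increasing_list W s = map \<sigma> (increasing_list V r)"
proof -
  have V: "fin_linorder V r" and W: "fin_linorder W s" and "\<sigma> ` V = W"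
    using assms by (auto simp: order_bij_def bij_betw_def)
  have "sorted_wrt (lt_of s) (map \<sigma> (increasing_list V r))"
    unfolding sorted_wrt_map using increasing_list(2)[OF V]
    by (rule sorted_wrt_mono_rel[rotated])
      (use order_bij_lt_of[OF assms] increasing_list(1)[OF V] in auto)
  then show ?thesis
    using increasing_list(5)[OF W] increasing_list(1)[OF V] \<open>\<sigma> ` V = W\<close> by (metis list.set_map)
qed

lemma order_bij_unique:
  assumes "order_bij V r W s \<sigma>" "order_bij V r W s \<tau>" "v \<in> V"
  shows "\<sigma> v = \<tau> v"
proof -
  have "map \<sigma> (increasing_list V r) = map \<tau> (increasing_list V r)"
    using assms order_bij_increasing_list by metis
  moreover have "v \<in> set (increasing_list V r)"
    using assms increasing_list(1) by (metis order_bij_def)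
  ultimately show ?thesis by (simp add: map_eq_conv)
qed

lemma order_bij_exists:
  assumes V: "fin_linorder V r" and W: "fin_linorder W s" and card: "card V = card W"
  shows "\<exists>\<sigma>. order_bij V r W s \<sigma>"
proof -
  define xs where "xs = increasing_list V r"
  define ys where "ys = increasing_list W s"
  note xs = increasing_list[OF V, folded xs_def] and ys = increasing_list[OF W, folded ys_def]
  define \<sigma> where "\<sigma> v = ys ! (THE i. i < length xs \<and> xs ! i = v)" for v
  have \<sigma>: "\<sigma> (xs ! i) = ys ! i" if "i < length xs" for i
  proof -
    have "(THE j. j < length xs \<and> xs ! j = xs ! i) = i"
      using that xs(3) by (intro the_equality) (auto simp: nth_eq_iff_index_eq)
    then show ?thesis by (simp add: \<sigma>_def)
  qed
  have "map \<sigma> xs = ys"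
    by (rule nth_equalityI) (use \<sigma> xs(4) ys(4) card in auto)
  then have "\<sigma> ` V = W"
    using xs(1) ys(1) by (metis list.set_map)
  then have "bij_betw \<sigma> V W"
    using V card by (simp add: bij_betw_def eq_card_imp_inj_on fin_linorder_def)
  moreover have "(\<sigma> u, \<sigma> v) \<in> s" if uv: "u \<in> V" "v \<in> V" and "(u, v) \<in> r" for u v
  proof (cases "u = v")
    case True
    then show ?thesis
      using W \<open>\<sigma> ` V = W\<close> that by (auto simp: fin_linorder_def order_on_defs refl_on_def)
  next
    case False
    obtain i j where ij: "i < length xs" "j < length xs" "u = xs ! i" "v = xs ! j"
      using uv unfolding xs(1)[symmetric] in_set_conv_nth by blast
    have "\<not> j \<le> i"
    proof
      assume "j \<le> i"
      then have "lt_of r v u"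
        using ij xs(2) False by (metis le_neq_implies_less sorted_wrt_nth_less)
      moreover have "lt_of r u v"
        using that False by (simp add: lt_of_def)
      ultimately show False
        using that fin_linorder_lt_of(1,2)[OF V] by (metis transp_onD irreflp_onD)
    qed
    then have "lt_of s (ys ! i) (ys ! j)"
      using ys(2) ij xs(4) ys(4) card by (simp add: sorted_wrt_nth_less)
    then show ?thesis
      using \<sigma> ij by (simp add: lt_of_def)
  qed
  ultimately show ?thesis
    using V W by (auto simp: order_bij_def)
qed

lemma order_bij_id: "fin_linorder V r \<Longrightarrow> order_bij V r V r id"
  by (auto simp: order_bij_def)

lemma order_bij_comp:
  "order_bij V r W s \<sigma> \<Longrightarrow> order_bij W s X t \<tau> \<Longrightarrow> order_bij V r X t (\<tau> \<circ> \<sigma>)"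
  unfolding order_bij_def by (auto intro: bij_betw_trans dest: bij_betwE)


section \<open>Isomorphism of L-species is equinumerosity\<close>

lemma is_lspeciesI:
  assumes "\<And>V r. fin_linorder V r \<Longrightarrow> finite (lstr F V r)"
    and "\<And>V r W s \<sigma> x. order_bij V r W s \<sigma> \<Longrightarrow> x \<in> lstr F V r \<Longrightarrow>
      lrelabel F V r \<sigma> x \<in> lstr F W s"
    and "\<And>V r W s \<sigma> \<tau> x. order_bij V r W s \<sigma> \<Longrightarrow> (\<And>v. v \<in> V \<Longrightarrow> \<sigma> v = \<tau> v) \<Longrightarrow>
      x \<in> lstr F V r \<Longrightarrow> lrelabel F V r \<sigma> x = lrelabel F V r \<tau> x"
    and "\<And>V r x. fin_linorder V r \<Longrightarrow> x \<in> lstr F V r \<Longrightarrow> lrelabel F V r id x = x"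
    and "\<And>V r W s X t \<sigma> \<tau> x. order_bij V r W s \<sigma> \<Longrightarrow> order_bij W s X t \<tau> \<Longrightarrow> x \<in> lstr F V r \<Longrightarrow>
      lrelabel F V r (\<tau> \<circ> \<sigma>) x = lrelabel F W s \<tau> (lrelabel F V r \<sigma> x)"
  shows "is_lspecies F"
  unfolding is_lspecies_def by (intro conjI allI impI ballI funcsetI; (elim conjE)?) (blast intro: assms)+

lemma is_lspeciesD:
  assumes "is_lspecies F"
  shows "fin_linorder V r \<Longrightarrow> finite (lstr F V r)"
    and "order_bij V r W s \<sigma> \<Longrightarrow> lrelabel F V r \<sigma> \<in> lstr F V r \<rightarrow> lstr F W s"
    and "order_bij V r W s \<sigma> \<Longrightarrow> (\<And>v. v \<in> V \<Longrightarrow> \<sigma> v = \<tau> v) \<Longrightarrow> x \<in> lstr F V r \<Longrightarrow>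
      lrelabel F V r \<sigma> x = lrelabel F V r \<tau> x"
    and "fin_linorder V r \<Longrightarrow> x \<in> lstr F V r \<Longrightarrow> lrelabel F V r id x = x"
    and "order_bij V r W s \<sigma> \<Longrightarrow> order_bij W s X t \<rho> \<Longrightarrow> x \<in> lstr F V r \<Longrightarrow>
      lrelabel F V r (\<rho> \<circ> \<sigma>) x = lrelabel F W s \<rho> (lrelabel F V r \<sigma> x)"
proof -
  note F = assms[unfolded is_lspecies_def]
  show "fin_linorder V r \<Longrightarrow> finite (lstr F V r)"
    using F[THEN conjunct1] by blast
  show "order_bij V r W s \<sigma> \<Longrightarrow> lrelabel F V r \<sigma> \<in> lstr F V r \<rightarrow> lstr F W s"
    using F[THEN conjunct2, THEN conjunct1] by blast
  show "order_bij V r W s \<sigma> \<Longrightarrow> (\<And>v. v \<in> V \<Longrightarrow> \<sigma> v = \<tau> v) \<Longrightarrow> x \<in> lstr F V r \<Longrightarrow>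
      lrelabel F V r \<sigma> x = lrelabel F V r \<tau> x"
    using F[THEN conjunct2, THEN conjunct2, THEN conjunct1] by metis
  show "fin_linorder V r \<Longrightarrow> x \<in> lstr F V r \<Longrightarrow> lrelabel F V r id x = x"
    using F[THEN conjunct2, THEN conjunct2, THEN conjunct2, THEN conjunct1] by metis
  show "order_bij V r W s \<sigma> \<Longrightarrow> order_bij W s X t \<rho> \<Longrightarrow> x \<in> lstr F V r \<Longrightarrow>
      lrelabel F V r (\<rho> \<circ> \<sigma>) x = lrelabel F W s \<rho> (lrelabel F V r \<sigma> x)"
    using F[THEN conjunct2, THEN conjunct2, THEN conjunct2, THEN conjunct2] by metis
qed

lemma lrelabel_comp_unique:
  assumes "is_lspecies F" "order_bij V r W s \<sigma>" "order_bij W s X t \<tau>" "order_bij V r X t \<rho>"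
    and "x \<in> lstr F V r"
  shows "lrelabel F W s \<tau> (lrelabel F V r \<sigma> x) = lrelabel F V r \<rho> x"
proof -
  have "lrelabel F V r \<rho> x = lrelabel F V r (\<tau> \<circ> \<sigma>) x"
    using is_lspeciesD(3)[OF assms(1,4)] assms
      order_bij_unique[OF assms(4) order_bij_comp[OF assms(2,3)]] by blast
  then show ?thesis
    using is_lspeciesD(5)[OF assms(1,2,3)] assms by simp
qed

lemma lrelabel_bij_betw:
  assumes F: "is_lspecies F" and \<sigma>: "order_bij V r W s \<sigma>"
  shows "bij_betw (lrelabel F V r \<sigma>) (lstr F V r) (lstr F W s)"
proof -
  have V: "fin_linorder V r" and W: "fin_linorder W s" and "card W = card V"
    using \<sigma> by (auto simp: order_bij_def bij_betw_same_card)
  then obtain \<tau> where \<tau>: "order_bij W s V r \<tau>"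
    using order_bij_exists by metis
  have id: "lrelabel F V r id x = x" if "fin_linorder V r" "x \<in> lstr F V r" for V r x
    using is_lspeciesD(4)[OF F] that by blast
  show ?thesis
  proof (rule bij_betw_byWitness[where f' = "lrelabel F W s \<tau>"])
    show "\<forall>x\<in>lstr F V r. lrelabel F W s \<tau> (lrelabel F V r \<sigma> x) = x"
      using lrelabel_comp_unique[OF F \<sigma> \<tau> order_bij_id[OF V]] id[OF V] by auto
    show "\<forall>y\<in>lstr F W s. lrelabel F V r \<sigma> (lrelabel F W s \<tau> y) = y"
      using lrelabel_comp_unique[OF F \<tau> \<sigma> order_bij_id[OF W]] id[OF W] by auto
    show "lrelabel F V r \<sigma> ` lstr F V r \<subseteq> lstr F W s"
      "lrelabel F W s \<tau> ` lstr F W s \<subseteq> lstr F V r"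
      using is_lspeciesD(2)[OF F \<sigma>] is_lspeciesD(2)[OF F \<tau>] by blast+
  qed
qed

text \<open>
  Between two finite linear orders of the same size there is exactly one morphism. Hence one may
  choose one linear order of each size, an arbitrary bijection there, and carry it to all other
  orders along the unique isomorphisms; naturality is automatic.
\<close>

theorem lspecies_iso_if_equinumerous:
  fixes F :: "('a, 'b) lspecies" and G :: "('a, 'c) lspecies"
  assumes F: "is_lspecies F" and G: "is_lspecies G"
    and card: "\<And>V r. fin_linorder V r \<Longrightarrow> card (lstr F V r) = card (lstr G V r)"
  shows "F \<cong>\<^sub>L G"
proof -
  define rep where "rep n = (SOME p :: 'a set \<times> 'a rel. fin_linorder (fst p) (snd p) \<and> card (fst p) = n)"
    for n
  have "fin_linorder (fst (rep (card V))) (snd (rep (card V))) \<and> card (fst (rep (card V))) = card V"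
    if "fin_linorder V r" for V :: "'a set" and r
    unfolding rep_def by (rule someI[of _ "(V, r)"]) (use that in simp)
  moreover define R S where "R = fst \<circ> rep" and "S = snd \<circ> rep"
  ultimately have rep: "fin_linorder (R (card V)) (S (card V))" "card (R (card V)) = card V"
    if "fin_linorder V r" for V :: "'a set" and r
    using that by simp_all
  define to_rep where "to_rep V r = (SOME \<tau>. order_bij V r (R (card V)) (S (card V)) \<tau>)" for V r
  have to_rep: "order_bij V r (R (card V)) (S (card V)) (to_rep V r)"
    if "fin_linorder V r" for V r
    unfolding to_rep_def using order_bij_exists that rep[OF that] by (metis someI_ex)
  define of_rep where "of_rep V r = (SOME \<tau>. order_bij (R (card V)) (S (card V)) V r \<tau>)" for V r
  have of_rep: "order_bij (R (card V)) (S (card V)) V r (of_rep V r)"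
    if "fin_linorder V r" for V r
    unfolding of_rep_def using order_bij_exists that rep[OF that] by (metis someI_ex)
  define \<beta> where "\<beta> n = (SOME b. bij_betw b (lstr F (R n) (S n)) (lstr G (R n) (S n)))" for n
  have \<beta>: "bij_betw (\<beta> n) (lstr F (R n) (S n)) (lstr G (R n) (S n))"
    if "fin_linorder (R n) (S n)" for n
  proof -
    have "finite (lstr F (R n) (S n))" "finite (lstr G (R n) (S n))"
      using that F G by (auto simp: is_lspecies_def)
    then show ?thesis
      unfolding \<beta>_def using card[OF that] by (metis finite_same_card_bij someI_ex)
  qed
  define \<eta> where "\<eta> V r x = lrelabel G (R (card V)) (S (card V)) (of_rep V r)
    (\<beta> (card V) (lrelabel F V r (to_rep V r) x))" for V r x
  have "bij_betw (\<eta> V r) (lstr F V r) (lstr G V r)" if V: "fin_linorder V r" for V r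
    using bij_betw_trans[OF bij_betw_trans[OF lrelabel_bij_betw[OF F to_rep[OF V]]
          \<beta>[OF rep(1)[OF V]]] lrelabel_bij_betw[OF G of_rep[OF V]]]
    by (simp add: \<eta>_def[abs_def] comp_def)
  moreover have "\<eta> W s (lrelabel F V r \<sigma> x) = lrelabel G V r \<sigma> (\<eta> V r x)"
    if \<sigma>: "order_bij V r W s \<sigma>" and x: "x \<in> lstr F V r" for V r W s \<sigma> x
  proof -
    have V: "fin_linorder V r" and W: "fin_linorder W s" and [simp]: "card W = card V"
      using \<sigma> by (auto simp: order_bij_def bij_betw_same_card)
    define y where "y = \<beta> (card V) (lrelabel F V r (to_rep V r) x)"
    have "y \<in> lstr G (R (card V)) (S (card V))"
      unfolding y_def
      using x \<beta>[OF rep(1)[OF V]] lrelabel_bij_betw[OF F to_rep[OF V]] by (meson bij_betwE)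
    then have "lrelabel G V r \<sigma> (\<eta> V r x)
        = lrelabel G (R (card V)) (S (card V)) (of_rep W s) y"
      unfolding \<eta>_def y_def[symmetric]
      using lrelabel_comp_unique[OF G of_rep[OF V] \<sigma>] of_rep[OF W] by simp
    moreover have "lrelabel F W s (to_rep W s) (lrelabel F V r \<sigma> x)
        = lrelabel F V r (to_rep V r) x"
      using lrelabel_comp_unique[OF F \<sigma> _ to_rep[OF V]] to_rep[OF W] x by simp
    ultimately show ?thesis
      by (simp add: \<eta>_def y_def)
  qed
  ultimately show ?thesis
    using F G unfolding lspecies_iso_def by blast
qed


section \<open>Species and substitution\<close>

lemma elems_uset [simp]: "finite A \<Longrightarrow> elems (uset A) = A"
  by (simp add: elems_def uset_def Abs_fset_inverse)

lemma uset_eq_iff: "finite A \<Longrightarrow> finite B \<Longrightarrow> uset A = uset B \<longleftrightarrow> A = B"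
  by (metis elems_uset)

lemma uimage_uset [simp]: "finite A \<Longrightarrow> uimage f (uset A) = uset (f ` A)"
  by (simp add: uimage_def)

text \<open>
  The functor laws for species. A morphism is an injection \<open>\<sigma>\<close> on \<open>V\<close>, read as a bijection from
  \<open>V\<close> onto \<open>\<sigma> ` V\<close>.
\<close>

definition is_species :: "('a, 'b) species \<Rightarrow> bool"
  where "is_species F \<longleftrightarrow>
    (\<forall>V. finite V \<longrightarrow> finite (str F V)) \<and>
    (\<forall>V \<sigma>. finite V \<and> inj_on \<sigma> V \<longrightarrow> relabel F V \<sigma> \<in> str F V \<rightarrow> str F (\<sigma> ` V)) \<and>
    (\<forall>V \<sigma> \<tau>. finite V \<and> inj_on \<sigma> V \<and> (\<forall>v\<in>V. \<sigma> v = \<tau> v) \<longrightarrow>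
      (\<forall>x\<in>str F V. relabel F V \<sigma> x = relabel F V \<tau> x)) \<and>
    (\<forall>V. finite V \<longrightarrow> (\<forall>x\<in>str F V. relabel F V id x = x)) \<and>
    (\<forall>V \<sigma> \<tau>. finite V \<and> inj_on \<sigma> V \<and> inj_on \<tau> (\<sigma> ` V) \<longrightarrow>
      (\<forall>x\<in>str F V. relabel F V (\<tau> \<circ> \<sigma>) x = relabel F (\<sigma> ` V) \<tau> (relabel F V \<sigma> x)))"

lemma is_speciesI:
  assumes "\<And>V. finite V \<Longrightarrow> finite (str F V)"
    and "\<And>V \<sigma> x. finite V \<Longrightarrow> inj_on \<sigma> V \<Longrightarrow> x \<in> str F V \<Longrightarrow> relabel F V \<sigma> x \<in> str F (\<sigma> ` V)"
    and "\<And>V \<sigma> \<tau> x. finite V \<Longrightarrow> inj_on \<sigma> V \<Longrightarrow> (\<And>v. v \<in> V \<Longrightarrow> \<sigma> v = \<tau> v) \<Longrightarrow> x \<in> str F V \<Longrightarrow>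
      relabel F V \<sigma> x = relabel F V \<tau> x"
    and "\<And>V x. finite V \<Longrightarrow> x \<in> str F V \<Longrightarrow> relabel F V id x = x"
    and "\<And>V \<sigma> \<tau> x. finite V \<Longrightarrow> inj_on \<sigma> V \<Longrightarrow> inj_on \<tau> (\<sigma> ` V) \<Longrightarrow> x \<in> str F V \<Longrightarrow>
      relabel F V (\<tau> \<circ> \<sigma>) x = relabel F (\<sigma> ` V) \<tau> (relabel F V \<sigma> x)"
  shows "is_species F"
  unfolding is_species_def by (intro conjI allI impI ballI funcsetI) (blast intro: assms)+

lemma is_speciesD:
  assumes "is_species F" "finite V"
  shows "finite (str F V)"
    and "inj_on \<sigma> V \<Longrightarrow> x \<in> str F V \<Longrightarrow> relabel F V \<sigma> x \<in> str F (\<sigma> ` V)"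
    and "inj_on \<sigma> V \<Longrightarrow> (\<And>v. v \<in> V \<Longrightarrow> \<sigma> v = \<tau> v) \<Longrightarrow> x \<in> str F V \<Longrightarrow>
      relabel F V \<sigma> x = relabel F V \<tau> x"
    and "x \<in> str F V \<Longrightarrow> relabel F V id x = x"
    and "inj_on \<sigma> V \<Longrightarrow> inj_on \<rho> (\<sigma> ` V) \<Longrightarrow> x \<in> str F V \<Longrightarrow>
      relabel F V (\<rho> \<circ> \<sigma>) x = relabel F (\<sigma> ` V) \<rho> (relabel F V \<sigma> x)"
proof -
  note F = assms(1)[unfolded is_species_def]
  show "finite (str F V)"
    using F[THEN conjunct1] assms(2) by blast
  show "inj_on \<sigma> V \<Longrightarrow> x \<in> str F V \<Longrightarrow> relabel F V \<sigma> x \<in> str F (\<sigma> ` V)"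
    using F[THEN conjunct2, THEN conjunct1] assms(2) by blast
  show "inj_on \<sigma> V \<Longrightarrow> (\<And>v. v \<in> V \<Longrightarrow> \<sigma> v = \<tau> v) \<Longrightarrow> x \<in> str F V \<Longrightarrow>
      relabel F V \<sigma> x = relabel F V \<tau> x"
    using F[THEN conjunct2, THEN conjunct2, THEN conjunct1] assms(2) by metis
  show "x \<in> str F V \<Longrightarrow> relabel F V id x = x"
    using F[THEN conjunct2, THEN conjunct2, THEN conjunct2, THEN conjunct1] assms(2) by metis
  show "inj_on \<sigma> V \<Longrightarrow> inj_on \<rho> (\<sigma> ` V) \<Longrightarrow> x \<in> str F V \<Longrightarrow>
      relabel F V (\<rho> \<circ> \<sigma>) x = relabel F (\<sigma> ` V) \<rho> (relabel F V \<sigma> x)"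
    using F[THEN conjunct2, THEN conjunct2, THEN conjunct2, THEN conjunct2] assms(2) by metis
qed

lemma is_lspecies_forget_order:
  assumes "is_species F"
  shows "is_lspecies (forget_order F)"
proof -
  note F = is_speciesD[OF assms]
  have fin: "fin_linorder V r \<Longrightarrow> finite V" for V :: "'a set" and r
    by (simp add: fin_linorder_def)
  have bij: "finite V" "inj_on \<sigma> V" "\<sigma> ` V = W" if "order_bij V r W s \<sigma>"
    for V W :: "'a set" and r s \<sigma>
    using that by (auto simp: order_bij_def fin_linorder_def bij_betw_def)
  show ?thesis
    unfolding is_lspecies_def forget_order_def lspecies.simps
  proof (intro conjI allI impI ballI funcsetI; (elim conjE)?)
    fix V r W s \<sigma> x
    assume *: "order_bij V r W s \<sigma>" "x \<in> str F V"
    then show "relabel F V \<sigma> x \<in> str F W"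
      using F(2)[of V \<sigma> x] bij[OF *(1)] by metis
  next
    fix V r W s \<sigma> \<tau> x
    assume *: "order_bij V r W s \<sigma>" "\<forall>v\<in>V. \<sigma> v = \<tau> v" "x \<in> str F V"
    then show "relabel F V \<sigma> x = relabel F V \<tau> x"
      using F(3)[of V \<sigma> \<tau> x] bij[OF *(1)] by metis
  next
    fix V r W s X t \<sigma> \<tau> x
    assume *: "order_bij V r W s \<sigma>" "order_bij W s X t \<tau>" "x \<in> str F V"
    then show "relabel F V (\<tau> \<circ> \<sigma>) x = relabel F W \<tau> (relabel F V \<sigma> x)"
      using F(5)[of V \<sigma> \<tau> x] bij[OF *(1)] bij[OF *(2)] by metis
  qed (use F(1,4) fin in blast)+
qed

lemma is_species_set_species: "is_species \<E>"
  by (rule is_speciesI) (auto simp: set_species_def image_comp intro: arg_cong[where f = uset])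

lemma str_list_species:
  "finite V \<Longrightarrow> str \<L> V = UList ` permutations_of_set V"
  by (auto simp: list_species_def permutations_of_set_def distinct_card
      intro!: imageI card_distinct)

lemma is_species_list_species: "is_species \<L>"
proof (rule is_speciesI)
  fix V :: "'a univ set" and \<sigma> :: "'a univ \<Rightarrow> 'a univ" and x
  assume "finite V" "inj_on \<sigma> V" "x \<in> str \<L> V"
  then show "relabel \<L> V \<sigma> x \<in> str \<L> (\<sigma> ` V)"
    by (auto simp: list_species_def card_image)
qed (auto simp: str_list_species, auto simp: list_species_def permutations_of_set_def)

lemma is_species_restrict_card: "is_species F \<Longrightarrow> is_species (restrict_card F k)"
  by (rule is_speciesI)
    (auto simp: restrict_card_def card_image is_speciesD(1,2,4,5) split: if_splits
      intro: is_speciesD(3))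

lemma is_species_nonempty_part: "is_species F \<Longrightarrow> is_species (nonempty_part F)"
  by (rule is_speciesI) (auto simp: nonempty_part_def is_speciesD(1,2,4,5) split: if_splits intro: is_speciesD(3))

definition subst_struct ::
    "'a univ set set \<Rightarrow> 'a univ \<Rightarrow> ('a univ set \<Rightarrow> 'a univ) \<Rightarrow> 'a univ"
  where "subst_struct P f h = UPair (uset (uset ` P)) (UPair f (ufamily P h))"

lemma str_subst:
  "str (F \<odot> G) V = (\<lambda>(P, f, h). subst_struct P f h) `
    (SIGMA P : {P. partition_on V P}. str F (uset ` P) \<times> (\<Pi>\<^sub>E B\<in>P. str G B))"
  by (force simp: subst_species_def subst_struct_def)

lemma subst_struct_in_str:
  assumes "partition_on V P" "f \<in> str F (uset ` P)" "h \<in> (\<Pi>\<^sub>E B\<in>P. str G B)"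
  shows "subst_struct P f h \<in> str (F \<odot> G) V"
  unfolding str_subst by (rule image_eqI[of _ _ "(P, f, h)"]) (use assms in auto)

lemma finite_partition_on:
  assumes "finite V" "partition_on V P"
  shows "finite P" "B \<in> P \<Longrightarrow> finite B" "B \<in> P \<Longrightarrow> B \<noteq> {}" "B \<in> P \<Longrightarrow> B \<subseteq> V"
  using assms finite_elements partition_onD1 partition_onD3
  by (blast, metis Sup_upper finite_subset partition_onD1, metis partition_onD3,
      metis Sup_upper partition_onD1)

lemma subst_struct_inj:
  assumes "finite P" "\<And>B. B \<in> P \<Longrightarrow> finite B" "finite Q" "\<And>B. B \<in> Q \<Longrightarrow> finite B"
    and "subst_struct P f h = subst_struct Q g k"
  shows "P = Q" "f = g" "B \<in> P \<Longrightarrow> h B = k B"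
proof -
  have "uset ` P = uset ` Q"
    using assms by (simp add: subst_struct_def uset_eq_iff)
  then have "elems ` uset ` P = elems ` uset ` Q"
    by simp
  then show "P = Q"
    using assms by (simp add: image_image)
  show "f = g"
    using assms by (simp add: subst_struct_def)
  show "h B = k B" if "B \<in> P"
  proof -
    have eq: "(\<lambda>B. UPair (uset B) (h B)) ` P = (\<lambda>B. UPair (uset B) (k B)) ` P"
      using assms \<open>P = Q\<close> by (simp add: subst_struct_def ufamily_def uset_eq_iff)
    have "UPair (uset B) (h B) \<in> (\<lambda>B. UPair (uset B) (k B)) ` P"
      unfolding eq[symmetric] using that by (rule imageI)
    then obtain C where "C \<in> P" "UPair (uset B) (h B) = UPair (uset C) (k C)"
      by blast
    then show ?thesis
      using assms(2) that by (auto simp: uset_eq_iff)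
  qed
qed

text \<open>
  If \<open>\<sigma>\<close> is injective, every block of the relabelled partition is the image of only one block, so
  that the relabelled family can be described by a function \<open>h'\<close>. Leaving \<open>h'\<close> abstract, subject to
  its values on the image blocks, avoids inverse functions in the proofs of the functor laws.
\<close>

lemma relabel_subst:
  assumes "finite P" "\<forall>B\<in>P. finite B"
    and "\<forall>B\<in>P. h' (\<sigma> ` B) = relabel G B \<sigma> (h B)"
  shows "relabel (F \<odot> G) V \<sigma> (subst_struct P f h) =
    subst_struct ((`) \<sigma> ` P) (relabel F (uset ` P) (uimage \<sigma>) f) h'"
  using assms
  by (auto simp: subst_species_def subst_struct_def ufamily_def image_image
      intro!: arg_cong[where f = uset] image_cong)

lemma inj_on_uimage:
  assumes "\<And>B. B \<in> P \<Longrightarrow> finite B" "inj_on \<sigma> (\<Union>P)"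
  shows "inj_on (uimage \<sigma>) (uset ` P)"
proof (rule inj_onI)
  fix x y
  assume xy: "x \<in> uset ` P" "y \<in> uset ` P" "uimage \<sigma> x = uimage \<sigma> y"
  then obtain B C where BC: "B \<in> P" "C \<in> P" "x = uset B" "y = uset C"
    by auto
  then have "\<sigma> ` B = \<sigma> ` C"
    using xy assms(1) by (simp add: uset_eq_iff)
  then have "B = C"
    using inj_on_image_eq_iff[OF assms(2)] BC by blast
  then show "x = y"
    using BC by simp
qed

lemma relabel_subst_family:
  assumes G: "is_species G" and V: "finite V" "partition_on V P" and \<sigma>: "inj_on \<sigma> V"
    and h: "h \<in> (\<Pi>\<^sub>E B\<in>P. str G B)"
  shows "\<exists>h'\<in>(\<Pi>\<^sub>E B\<in>(`) \<sigma> ` P. str G B). \<forall>B\<in>P. h' (\<sigma> ` B) = relabel G B \<sigma> (h B)"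
proof -
  note P = finite_partition_on[OF V]
  have inj: "inj_on ((`) \<sigma>) P"
    by (rule inj_onI) (metis P(4) \<sigma> inj_on_image_eq_iff)
  define h' where "h' = (\<lambda>C\<in>(`) \<sigma> ` P. relabel G (inv_into P ((`) \<sigma>) C) \<sigma> (h (inv_into P ((`) \<sigma>) C)))"
  have *: "h' (\<sigma> ` B) = relabel G B \<sigma> (h B)" if "B \<in> P" for B
    using that inj by (simp add: h'_def inv_into_f_f)
  have "h' \<in> (\<Pi>\<^sub>E B\<in>(`) \<sigma> ` P. str G B)"
  proof (rule PiE_I)
    fix C assume "C \<in> (`) \<sigma> ` P"
    then obtain B where B: "B \<in> P" "C = \<sigma> ` B" by auto
    then show "h' C \<in> str G C"
      using * is_speciesD(2)[OF G P(2)[OF B(1)]] inj_on_subset[OF \<sigma> P(4)[OF B(1)]] h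
      by (auto simp: PiE_iff)
  qed (simp add: h'_def)
  with * show ?thesis by blast
qed

lemma partition_on_image:
  assumes "partition_on V P" "inj_on \<sigma> V"
  shows "partition_on (\<sigma> ` V) ((`) \<sigma> ` P)"
proof -
  have "{} \<notin> (`) \<sigma> ` P"
    using partition_onD3[OF assms(1)] by auto
  then show ?thesis
    using partition_on_inj_image[OF assms] by simp
qed

lemma is_species_subst:
  assumes F: "is_species F" and G: "is_species G"
  shows "is_species (F \<odot> G)"
proof (rule is_speciesI)
  fix V :: "'a univ set"
  assume V: "finite V"
  show "finite (str (F \<odot> G) V)"
    unfolding str_subst using V finite_partition_on[OF V]
    by (intro finite_imageI finite_SigmaI finitely_many_partition_on finite_cartesian_product
        finite_PiE is_speciesD[OF F] is_speciesD[OF G]) auto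
next
  fix V :: "'a univ set" and \<sigma> :: "'a univ \<Rightarrow> 'a univ" and x
  assume V: "finite V" and \<sigma>: "inj_on \<sigma> V" and x: "x \<in> str (F \<odot> G) V"
  then obtain P f h where P: "partition_on V P" and f: "f \<in> str F (uset ` P)"
    and h: "h \<in> (\<Pi>\<^sub>E B\<in>P. str G B)" and x: "x = subst_struct P f h"
    by (auto simp: str_subst)
  note fin = finite_partition_on[OF V P]
  from relabel_subst_family[OF G V P \<sigma> h]
  obtain h' where h': "h' \<in> (\<Pi>\<^sub>E B\<in>(`) \<sigma> ` P. str G B)"
    and "\<forall>B\<in>P. h' (\<sigma> ` B) = relabel G B \<sigma> (h B)" ..
  note * = this(2)[rule_format]
  have inj: "inj_on (uimage \<sigma>) (uset ` P)"
    using inj_on_uimage fin(2) \<sigma> P partition_onD1 by metis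
  have "uimage \<sigma> ` uset ` P = uset ` (`) \<sigma> ` P"
    using fin(2) by (simp add: image_image)
  then have f': "relabel F (uset ` P) (uimage \<sigma>) f \<in> str F (uset ` (`) \<sigma> ` P)"
    using is_speciesD(2)[OF F _ inj f] fin(1) by simp
  have eq: "relabel (F \<odot> G) V \<sigma> x =
      subst_struct ((`) \<sigma> ` P) (relabel F (uset ` P) (uimage \<sigma>) f) h'"
    unfolding x by (rule relabel_subst[OF fin(1)]) (rule ballI, erule fin(2), rule ballI, erule *)
  show "relabel (F \<odot> G) V \<sigma> x \<in> str (F \<odot> G) (\<sigma> ` V)"
    unfolding eq by (rule subst_struct_in_str[OF partition_on_image[OF P \<sigma>] f' h'])
next
  fix V :: "'a univ set" and \<sigma> \<tau> :: "'a univ \<Rightarrow> 'a univ" and x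
  assume V: "finite V" and \<sigma>: "inj_on \<sigma> V" and eq: "\<And>v. v \<in> V \<Longrightarrow> \<sigma> v = \<tau> v"
    and x: "x \<in> str (F \<odot> G) V"
  then obtain P f h where P: "partition_on V P" and f: "f \<in> str F (uset ` P)"
    and h: "h \<in> (\<Pi>\<^sub>E B\<in>P. str G B)" and x: "x = subst_struct P f h"
    by (auto simp: str_subst)
  note fin = finite_partition_on[OF V P]
  from relabel_subst_family[OF G V P \<sigma> h]
  obtain h' where "\<forall>B\<in>P. h' (\<sigma> ` B) = relabel G B \<sigma> (h B)" ..
  note * = this[rule_format]
  have eq1: "relabel (F \<odot> G) V \<sigma> x =
      subst_struct ((`) \<sigma> ` P) (relabel F (uset ` P) (uimage \<sigma>) f) h'"
    unfolding x by (rule relabel_subst[OF fin(1)]) (rule ballI, erule fin(2), rule ballI, erule *)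
  have im: "\<sigma> ` B = \<tau> ` B" if "B \<in> P" for B
    using fin(4)[OF that] eq by (auto intro!: image_cong)
  have **: "h' (\<tau> ` B) = relabel G B \<tau> (h B)" if B: "B \<in> P" for B
    unfolding im[OF B, symmetric] *[OF B]
    by (rule is_speciesD(3)[OF G fin(2)[OF B] inj_on_subset[OF \<sigma> fin(4)[OF B]]])
      (use eq fin(4)[OF B] PiE_mem[OF h B] in blast)+
  have eq2: "relabel (F \<odot> G) V \<tau> x =
      subst_struct ((`) \<tau> ` P) (relabel F (uset ` P) (uimage \<tau>) f) h'"
    unfolding x by (rule relabel_subst[OF fin(1)]) (rule ballI, erule fin(2), rule ballI, erule **)
  have inj: "inj_on (uimage \<sigma>) (uset ` P)"
    using inj_on_uimage fin(2) \<sigma> P partition_onD1 by metis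
  have "relabel F (uset ` P) (uimage \<sigma>) f = relabel F (uset ` P) (uimage \<tau>) f"
    by (rule is_speciesD(3)[OF F _ inj _ f]) (use fin(1,2) im in auto)
  moreover have "(`) \<sigma> ` P = (`) \<tau> ` P"
    using im by (auto intro!: image_cong)
  ultimately show "relabel (F \<odot> G) V \<sigma> x = relabel (F \<odot> G) V \<tau> x"
    unfolding eq1 eq2 by simp
next
  fix V :: "'a univ set" and x
  assume V: "finite V" and x: "x \<in> str (F \<odot> G) V"
  then obtain P f h where P: "partition_on V P" and f: "f \<in> str F (uset ` P)"
    and h: "h \<in> (\<Pi>\<^sub>E B\<in>P. str G B)" and x: "x = subst_struct P f h"
    by (auto simp: str_subst)
  note fin = finite_partition_on[OF V P]
  have *: "h (id ` B) = relabel G B id (h B)" if B: "B \<in> P" for B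
    using is_speciesD(4)[OF G fin(2)[OF B] PiE_mem[OF h B]] by simp
  have eq: "relabel (F \<odot> G) V id x =
      subst_struct ((`) id ` P) (relabel F (uset ` P) (uimage id) f) h"
    unfolding x by (rule relabel_subst[OF fin(1)]) (rule ballI, erule fin(2), rule ballI, erule *)
  have inj: "inj_on (uimage id) (uset ` P)"
    using inj_on_uimage[of P id] fin(2) by simp
  have "relabel F (uset ` P) (uimage id) f = relabel F (uset ` P) id f"
    by (rule is_speciesD(3)[OF F _ inj _ f]) (use fin(1,2) in auto)
  then show "relabel (F \<odot> G) V id x = x"
    unfolding eq using is_speciesD(4)[OF F _ f] fin(1) x by simp
next
  fix V :: "'a univ set" and \<sigma> \<tau> :: "'a univ \<Rightarrow> 'a univ" and x
  assume V: "finite V" and \<sigma>: "inj_on \<sigma> V" and \<tau>: "inj_on \<tau> (\<sigma> ` V)"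
    and x: "x \<in> str (F \<odot> G) V"
  then obtain P f h where P: "partition_on V P" and f: "f \<in> str F (uset ` P)"
    and h: "h \<in> (\<Pi>\<^sub>E B\<in>P. str G B)" and x: "x = subst_struct P f h"
    by (auto simp: str_subst)
  note fin = finite_partition_on[OF V P]
  note P' = partition_on_image[OF P \<sigma>]
  have V': "finite (\<sigma> ` V)" using V by simp
  note fin' = finite_partition_on[OF V' P']
  from relabel_subst_family[OF G V P \<sigma> h]
  obtain h' where h': "h' \<in> (\<Pi>\<^sub>E B\<in>(`) \<sigma> ` P. str G B)"
    and "\<forall>B\<in>P. h' (\<sigma> ` B) = relabel G B \<sigma> (h B)" ..
  note * = this(2)[rule_format]
  from relabel_subst_family[OF G V' P' \<tau> h']
  obtain h'' where "\<forall>B\<in>(`) \<sigma> ` P. h'' (\<tau> ` B) = relabel G B \<tau> (h' B)" ..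
  note ** = this[THEN bspec]
  have ***: "h'' ((\<tau> \<circ> \<sigma>) ` B) = relabel G B (\<tau> \<circ> \<sigma>) (h B)" if B: "B \<in> P" for B
  proof -
    have "h'' (\<tau> ` \<sigma> ` B) = relabel G (\<sigma> ` B) \<tau> (relabel G B \<sigma> (h B))"
      using **[OF imageI[OF B]] *[OF B] by simp
    also have "\<dots> = relabel G B (\<tau> \<circ> \<sigma>) (h B)"
      by (rule is_speciesD(5)[OF G fin(2)[OF B] inj_on_subset[OF \<sigma> fin(4)[OF B]]
        inj_on_subset[OF \<tau> image_mono[OF fin(4)[OF B]]] PiE_mem[OF h B], symmetric])
    finally show ?thesis
      by (simp add: image_comp)
  qed
  have eq1: "relabel (F \<odot> G) V \<sigma> x =
      subst_struct ((`) \<sigma> ` P) (relabel F (uset ` P) (uimage \<sigma>) f) h'"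
    unfolding x by (rule relabel_subst[OF fin(1)]) (rule ballI, erule fin(2), rule ballI, erule *)
  have eq2: "relabel (F \<odot> G) (\<sigma> ` V) \<tau>
        (subst_struct ((`) \<sigma> ` P) (relabel F (uset ` P) (uimage \<sigma>) f) h') =
      subst_struct ((`) \<tau> ` (`) \<sigma> ` P) (relabel F (uset ` (`) \<sigma> ` P) (uimage \<tau>)
        (relabel F (uset ` P) (uimage \<sigma>) f)) h''"
    by (rule relabel_subst[OF fin'(1)]) (rule ballI, erule fin'(2), rule ballI, erule **)
  have eq3: "relabel (F \<odot> G) V (\<tau> \<circ> \<sigma>) x =
      subst_struct ((`) (\<tau> \<circ> \<sigma>) ` P) (relabel F (uset ` P) (uimage (\<tau> \<circ> \<sigma>)) f) h''"
    unfolding x by (rule relabel_subst[OF fin(1)]) (rule ballI, erule fin(2), rule ballI, erule ***)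
  have inj: "inj_on (uimage \<sigma>) (uset ` P)"
    using inj_on_uimage fin(2) \<sigma> P partition_onD1 by metis
  have im: "uimage \<sigma> ` uset ` P = uset ` (`) \<sigma> ` P"
    using fin(2) by (simp add: image_image)
  have inj': "inj_on (uimage \<tau>) (uimage \<sigma> ` uset ` P)"
    unfolding im using inj_on_uimage fin'(2) \<tau> P' partition_onD1 by metis
  have inj'': "inj_on (uimage (\<tau> \<circ> \<sigma>)) (uset ` P)"
    using inj_on_uimage[of P "\<tau> \<circ> \<sigma>"] fin(2) comp_inj_on[OF \<sigma> \<tau>] P partition_onD1 by metis
  have "relabel F (uset ` P) (uimage (\<tau> \<circ> \<sigma>)) f
      = relabel F (uset ` P) (uimage \<tau> \<circ> uimage \<sigma>) f"
    by (rule is_speciesD(3)[OF F _ inj'' _ f]) (use fin(1,2) in \<open>auto simp: image_comp\<close>)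
  also have "\<dots> = relabel F (uset ` (`) \<sigma> ` P) (uimage \<tau>) (relabel F (uset ` P) (uimage \<sigma>) f)"
    using is_speciesD(5)[OF F _ inj inj' f] fin(1) im by simp
  finally show "relabel (F \<odot> G) V (\<tau> \<circ> \<sigma>) x = relabel (F \<odot> G) (\<sigma> ` V) \<tau> (relabel (F \<odot> G) V \<sigma> x)"
    unfolding eq1 eq2 eq3 by (simp add: image_image image_comp comp_def)
qed

text \<open>
  Triples of a partition, an \<open>F\<close>-structure and a family of \<open>G\<close>-structures are encoded without
  collisions, so the structures are counted by the triples.
\<close>

lemma card_str_subst:
  assumes F: "is_species F" and G: "is_species G" and V: "finite V"
  shows "card (str (F \<odot> G) V) =
    (\<Sum>P | partition_on V P. card (str F (uset ` P)) * (\<Prod>B\<in>P. card (str G B)))"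
proof -
  have "inj_on (\<lambda>(P, f, h). subst_struct P f h)
    (SIGMA P : {P. partition_on V P}. str F (uset ` P) \<times> (\<Pi>\<^sub>E B\<in>P. str G B))"
  proof (rule inj_onI)
    fix s t
    assume "s \<in> (SIGMA P : {P. partition_on V P}. str F (uset ` P) \<times> (\<Pi>\<^sub>E B\<in>P. str G B))"
      "t \<in> (SIGMA P : {P. partition_on V P}. str F (uset ` P) \<times> (\<Pi>\<^sub>E B\<in>P. str G B))"
      and eq: "(\<lambda>(P, f, h). subst_struct P f h) s = (\<lambda>(P, f, h). subst_struct P f h) t"
    then obtain P f h P' f' h' where st: "s = (P, f, h)" "t = (P', f', h')"
      and P: "partition_on V P" "partition_on V P'"
      and h: "h \<in> (\<Pi>\<^sub>E B\<in>P. str G B)" "h' \<in> (\<Pi>\<^sub>E B\<in>P'. str G B)"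
      by blast
    from eq have "subst_struct P f h = subst_struct P' f' h'"
      by (simp add: st)
    with subst_struct_inj[OF finite_partition_on(1,2)[OF V P(1)] finite_partition_on(1,2)[OF V P(2)]]
    have *: "P = P'" "f = f'" "\<And>B. B \<in> P \<Longrightarrow> h B = h' B"
      by blast+
    then show "s = t"
      using h PiE_ext[of h P "str G" h'] by (simp add: st)
  qed
  then have "card (str (F \<odot> G) V) =
      card (SIGMA P : {P. partition_on V P}. str F (uset ` P) \<times> (\<Pi>\<^sub>E B\<in>P. str G B))"
    unfolding str_subst by (rule card_image)
  also have "\<dots> = (\<Sum>P | partition_on V P. card (str F (uset ` P) \<times> (\<Pi>\<^sub>E B\<in>P. str G B)))"
    using finite_partition_on[OF V] V
    by (intro card_SigmaI finitely_many_partition_on ballI finite_cartesian_product finite_PiE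
        is_speciesD[OF F] is_speciesD[OF G]) auto
  also have "\<dots> = (\<Sum>P | partition_on V P. card (str F (uset ` P)) * (\<Prod>B\<in>P. card (str G B)))"
    using finite_partition_on[OF V]
    by (intro sum.cong refl) (simp add: card_cartesian_product card_PiE)
  finally show ?thesis .
qed


section \<open>Counting iterated lists\<close>

lemma sum_Pow_card:
  fixes g :: "nat \<Rightarrow> nat"
  assumes "finite V"
  shows "(\<Sum>B\<in>Pow V. g (card B)) = (\<Sum>j\<le>card V. (card V choose j) * g j)"
proof -
  have "(\<Sum>B\<in>Pow V. g (card B)) = (\<Sum>j\<le>card V. \<Sum>B | B \<in> Pow V \<and> card B = j. g (card B))"
    using assms by (intro sum.group[symmetric]) (auto intro: card_mono)
  also have "\<dots> = (\<Sum>j\<le>card V. (card V choose j) * g j)"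
    using n_subsets[OF assms] by (intro sum.cong refl) simp
  finally show ?thesis .
qed

text \<open>
  The sum counts linearly ordered partitions, weighted blockwise; the recursion splits off the
  first block.
\<close>

lemma sum_ordered_partitions_rec:
  fixes w :: "'a set \<Rightarrow> nat"
  assumes V: "finite V" "V \<noteq> {}"
  shows "(\<Sum>P | partition_on V P. fact (card P) * (\<Prod>B\<in>P. w B)) =
    (\<Sum>B\<in>Pow V - {{}}. w B * (\<Sum>P | partition_on (V - B) P. fact (card P) * (\<Prod>C\<in>P. w C)))"
proof -
  have fin: "finite {P. partition_on W P}" if "W \<subseteq> V" for W
    using that V by (simp add: finite_subset finitely_many_partition_on)
  have "(\<Sum>P | partition_on V P. fact (card P) * (\<Prod>B\<in>P. w B)) =
    (\<Sum>P | partition_on V P. \<Sum>B\<in>P. fact (card (P - {B})) * (\<Prod>C\<in>P - {B}. w C) * w B)"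
  proof (rule sum.cong[OF refl])
    fix P assume "P \<in> {P. partition_on V P}"
    then have P: "partition_on V P" "finite P" "P \<noteq> {}"
      using V finite_partition_on(1) partition_onD1 by fastforce+
    have "(\<Sum>B\<in>P. fact (card (P - {B})) * (\<Prod>C\<in>P - {B}. w C) * w B)
        = (\<Sum>B\<in>P. fact (card P - 1) * (\<Prod>C\<in>P. w C))"
      using P(2) by (intro sum.cong refl) (simp add: prod.remove[of P] mult_ac)
    also have "\<dots> = fact (card P) * (\<Prod>C\<in>P. w C)"
      using P by (simp add: fact_reduce card_gt_0_iff)
    finally show "fact (card P) * (\<Prod>B\<in>P. w B) =
      (\<Sum>B\<in>P. fact (card (P - {B})) * (\<Prod>C\<in>P - {B}. w C) * w B)" by simp
  qed
  also have "\<dots> = (\<Sum>(P, B)\<in>(SIGMA P : {P. partition_on V P}. P).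
      fact (card (P - {B})) * (\<Prod>C\<in>P - {B}. w C) * w B)"
    using fin finite_partition_on(1)[OF V(1)] by (intro sum.Sigma) auto
  also have "\<dots> = (\<Sum>(B, P)\<in>(SIGMA B : Pow V - {{}}. {P. partition_on (V - B) P}).
      w B * (fact (card P) * (\<Prod>C\<in>P. w C)))"
  proof -
    have rest: "partition_on (V - B) (P - {B})" if "partition_on V P" "B \<in> P" for P B
    proof -
      have "disjnt B C" if "C \<in> P - {B}" for C
        using that \<open>B \<in> P\<close> partition_onD2[OF \<open>partition_on V P\<close>]
        by (auto simp: disjoint_def disjnt_def)
      then have "disjnt B (\<Union>(P - {B}))"
        by (auto simp: disjnt_def)
      then show ?thesis
        using partition_on_insert[of B "P - {B}" V] that by (simp add: insert_absorb)
    qed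
    have new: "partition_on V (insert B P)" "B \<notin> P"
      if "B \<subseteq> V" "B \<noteq> {}" "partition_on (V - B) P" for P B
    proof -
      have "disjnt B (\<Union>P)"
        using partition_onD1[OF that(3)] by (auto simp: disjnt_def)
      then show "partition_on V (insert B P)" "B \<notin> P"
        using partition_on_insert[of B P V] that by (auto simp: disjnt_def)
    qed
    have block: "B \<subseteq> V" "B \<noteq> {}" if "partition_on V P" "B \<in> P" for P B
      using that finite_partition_on(3,4)[OF V(1)] by blast+
    show ?thesis
    proof (rule sum.reindex_bij_witness[of _ "\<lambda>(B, P). (insert B P, B)" "\<lambda>(P, B). (B, P - {B})"])
      fix x assume "x \<in> (SIGMA P : {P. partition_on V P}. P)"
      then obtain P B where x: "x = (P, B)" "partition_on V P" "B \<in> P" by blast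
      show "(case case x of (P, B) \<Rightarrow> (B, P - {B}) of (B, P) \<Rightarrow> (insert B P, B)) = x"
        using x by (simp add: insert_absorb)
      show "(case x of (P, B) \<Rightarrow> (B, P - {B})) \<in> (SIGMA B : Pow V - {{}}. {P. partition_on (V - B) P})"
        using x rest block by simp
      show "(case case x of (P, B) \<Rightarrow> (B, P - {B}) of (B, P) \<Rightarrow> w B * (fact (card P) * prod w P))
        = (case x of (P, B) \<Rightarrow> fact (card (P - {B})) * prod w (P - {B}) * w B)"
        using x by (simp add: mult_ac)
    next
      fix x assume "x \<in> (SIGMA B : Pow V - {{}}. {P. partition_on (V - B) P})"
      then obtain B P where x: "x = (B, P)" "B \<subseteq> V" "B \<noteq> {}" "partition_on (V - B) P" by blast
      show "(case case x of (B, P) \<Rightarrow> (insert B P, B) of (P, B) \<Rightarrow> (B, P - {B})) = x"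
        using x new by simp
      show "(case x of (B, P) \<Rightarrow> (insert B P, B)) \<in> (SIGMA P : {P. partition_on V P}. P)"
        using x new by simp
    qed
  qed
  also have "\<dots> = (\<Sum>B\<in>Pow V - {{}}. \<Sum>P | partition_on (V - B) P.
      w B * (fact (card P) * (\<Prod>C\<in>P. w C)))"
    using V fin by (intro sum.Sigma[symmetric]) auto
  also have "\<dots> = (\<Sum>B\<in>Pow V - {{}}. w B * (\<Sum>P | partition_on (V - B) P.
      fact (card P) * (\<Prod>C\<in>P. w C)))"
    by (simp add: sum_distrib_left)
  finally show ?thesis .
qed

text \<open>
  Comparison of coefficients in \<open>1 / (1 - c x) \<cdot> (1 - c x) / (1 - (c + 1) x) = 1 / (1 - (c + 1) x)\<close>.
\<close>

lemma sum_geometric_convolution: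
  "(\<Sum>i\<le>n. c ^ i * (if n - i = 0 then 1 else (c + 1) ^ (n - i - 1))) = (c + 1 :: nat) ^ n"
proof (induction n)
  case (Suc n)
  have "(\<Sum>i\<le>Suc n. c ^ i * (if Suc n - i = 0 then 1 else (c + 1) ^ (Suc n - i - 1)))
     = (c + 1) ^ n + (\<Sum>i\<le>n. c ^ Suc i * (if n - i = 0 then 1 else (c + 1) ^ (n - i - 1)))"
    by (subst sum.atMost_Suc_shift) (simp only: diff_Suc_Suc, simp)
  also have "(\<Sum>i\<le>n. c ^ Suc i * (if n - i = 0 then 1 else (c + 1) ^ (n - i - 1))) = c * (c + 1) ^ n"
    unfolding Suc.IH[symmetric] sum_distrib_left by (simp add: mult_ac)
  finally show ?case by simp
qed simp

text \<open>
  This is the identity \<open>L\<^sub>+(x / (1 - c x)) = x / (1 - (c + 1) x)\<close>, where \<open>L\<^sub>+(x) = x / (1 - x)\<close>,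
  for exponential generating functions.
\<close>

lemma sum_ordered_partitions_lists:
  assumes "finite V" "V \<noteq> {}"
  shows "(\<Sum>P | partition_on V P. fact (card P) * (\<Prod>B\<in>P. fact (card B) * c ^ (card B - 1))) =
    fact (card V) * (c + 1 :: nat) ^ (card V - 1)"
proof -
  define w where "w B = fact (card B) * c ^ (card B - 1)" for B :: "'a set"
  \<comment> \<open>\<open>b n\<close> is the coefficient of \<open>x ^ n\<close> in \<open>1 / (1 - x / (1 - c x))\<close>, which counts ordered
    partitions including the empty one.\<close>
  define b where "b n = (if n = 0 then 1 else (c + 1) ^ (n - 1))" for n
  have "(\<Sum>P | partition_on V P. fact (card P) * (\<Prod>B\<in>P. w B)) = fact (card V) * b (card V)"
    using assms(1)
  proof (induction "card V" arbitrary: V rule: less_induct)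
    case less
    show ?case
    proof (cases "V = {}")
      case True
      have "{P. partition_on ({} :: 'a set) P} = {{}}"
        by (auto simp: partition_on_empty)
      then show ?thesis
        unfolding True by (simp add: b_def)
    next
      case False
      define n where "n = card V - 1"
      have n: "card V = Suc n"
        using False less.prems by (simp add: n_def card_gt_0_iff)
      define g where "g j = (if j = 0 then 0
        else fact j * c ^ (j - 1) * (fact (card V - j) * b (card V - j)))" for j
      have "(\<Sum>P | partition_on V P. fact (card P) * (\<Prod>B\<in>P. w B)) =
        (\<Sum>B\<in>Pow V - {{}}. w B * (\<Sum>P | partition_on (V - B) P. fact (card P) * (\<Prod>C\<in>P. w C)))"
        using sum_ordered_partitions_rec[OF less.prems False] .
      also have "\<dots> = (\<Sum>B\<in>Pow V - {{}}. g (card B))"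
      proof (rule sum.cong[OF refl])
        fix B assume B: "B \<in> Pow V - {{}}"
        then have "finite B"
          using less.prems finite_subset by blast
        then have "card B > 0" "card (V - B) = card V - card B" "card B \<le> card V"
          using B less.prems by (simp_all add: card_gt_0_iff card_Diff_subset card_mono)
        moreover from this have "card (V - B) < card V"
          by linarith
        ultimately show "w B * (\<Sum>P | partition_on (V - B) P. fact (card P) * (\<Prod>C\<in>P. w C)) = g (card B)"
          using less.hyps[of "V - B"] less.prems by (simp add: w_def g_def)
      qed
      also have "\<dots> = (\<Sum>B\<in>Pow V. g (card B))"
        using less.prems by (intro sum.mono_neutral_left) (auto simp: g_def)
      also have "\<dots> = (\<Sum>j\<le>Suc n. (card V choose j) * g j)"
        using sum_Pow_card[OF less.prems] n by simp
      also have "\<dots> = (\<Sum>i\<le>n. (card V choose Suc i) * g (Suc i))"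
        by (subst sum.atMost_Suc_shift) (simp add: g_def)
      also have "\<dots> = (\<Sum>i\<le>n. fact (card V) * (c ^ i * b (n - i)))"
      proof (rule sum.cong[OF refl])
        fix i assume "i \<in> {..n}"
        then have fact_n: "fact (Suc i) * fact (card V - Suc i) * (card V choose Suc i) = fact (card V)"
          by (intro binomial_fact_lemma) (simp add: n)
        show "(card V choose Suc i) * g (Suc i) = fact (card V) * (c ^ i * b (n - i))"
          unfolding fact_n[symmetric] unfolding g_def n
          by (simp del: fact_Suc binomial_Suc_Suc add: mult_ac)
      qed
      also have "\<dots> = fact (card V) * (c + 1) ^ n"
        using sum_geometric_convolution[of c n] by (simp add: sum_distrib_left[symmetric] b_def)
      finally show ?thesis
        using n by (simp add: b_def)
    qed
  qed
  then show ?thesis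
    using assms by (simp add: w_def b_def)
qed

lemma iterated_subst_Suc:
  "iterated_subst G (Suc (Suc m)) = G \<odot> iterated_subst G (Suc m)"
  by (simp add: iterated_subst_def)

lemma is_species_iterated_subst:
  assumes "is_species G"
  shows "is_species (iterated_subst G (Suc m))"
proof (induction m)
  case 0
  then show ?case using assms by (simp add: iterated_subst_def)
next
  case (Suc m)
  then show ?case
    unfolding iterated_subst_Suc using is_species_subst assms by blast
qed

lemma card_nonempty_lists:
  assumes "finite V" "V \<noteq> {}"
  shows "card (str (nonempty_part \<L>) V) = fact (card V)"
proof -
  have "card (UList ` permutations_of_set V) = card (permutations_of_set V)"
    by (intro card_image inj_onI) simp
  then show ?thesis
    using assms by (simp add: nonempty_part_def str_list_species)
qed

lemma card_iterated_lists:
  assumes "finite V" "V \<noteq> {}"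
  shows "card (str (iterated_subst (nonempty_part \<L>) (Suc m)) V) = fact (card V) * Suc m ^ (card V - 1)"
  using assms
proof (induction m arbitrary: V)
  case 0
  then show ?case by (simp add: iterated_subst_def card_nonempty_lists)
next
  case (Suc m)
  let ?L = "nonempty_part \<L> :: ('a univ, 'a univ) species"
  have "card (str (iterated_subst ?L (Suc (Suc m))) V) =
    (\<Sum>P | partition_on V P. card (str ?L (uset ` P)) *
      (\<Prod>B\<in>P. card (str (iterated_subst ?L (Suc m)) B)))"
    unfolding iterated_subst_Suc using Suc.prems
    by (intro card_str_subst is_species_iterated_subst is_species_nonempty_part is_species_list_species)
  also have "\<dots> = (\<Sum>P | partition_on V P.
      fact (card P) * (\<Prod>B\<in>P. fact (card B) * Suc m ^ (card B - 1)))"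
  proof (rule sum.cong[OF refl])
    fix P assume "P \<in> {P. partition_on V P}"
    then have P: "partition_on V P" by simp
    note fin = finite_partition_on[OF Suc.prems(1) P]
    have "P \<noteq> {}"
      using P Suc.prems partition_onD1 by fastforce
    moreover have "card (uset ` P) = card P"
      using fin(2) by (intro card_image inj_onI) (simp add: uset_eq_iff)
    ultimately have "card (str ?L (uset ` P)) = fact (card P)"
      using fin(1) by (subst card_nonempty_lists) auto
    moreover have "(\<Prod>B\<in>P. card (str (iterated_subst ?L (Suc m)) B)) =
        (\<Prod>B\<in>P. fact (card B) * Suc m ^ (card B - 1))"
      using fin Suc.IH by (intro prod.cong refl) blast
    ultimately show "card (str ?L (uset ` P)) *
        (\<Prod>B\<in>P. card (str (iterated_subst ?L (Suc m)) B)) =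
        fact (card P) * (\<Prod>B\<in>P. fact (card B) * Suc m ^ (card B - 1))"
      by simp
  qed
  also have "\<dots> = fact (card V) * (Suc m + 1) ^ (card V - 1)"
    using Suc.prems by (intro sum_ordered_partitions_lists)
  finally show ?case by simp
qed


section \<open>Counting connected configurations\<close>

text \<open>
  The graph on the labels whose edges are the hyperplanes of the arrangement that contain \<open>x\<close>.
\<close>

definition shi_adj :: "nat \<Rightarrow> 'a rel \<Rightarrow> ('a \<Rightarrow> int) \<Rightarrow> 'a \<Rightarrow> 'a \<Rightarrow> bool"
  where "shi_adj m r x u v \<longleftrightarrow>
    lt_of r u v \<and> x u - x v \<in> {1 - int m..int m} \<or>
    lt_of r v u \<and> x v - x u \<in> {1 - int m..int m}"

text \<open>
  The restrictions to \<open>B\<close> of the points of a flat that has \<open>B\<close> as a block are translates of one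
  integer vector. Placing the lowest element at \<open>0\<close> selects one of the translates.
\<close>

definition connected_configs :: "nat \<Rightarrow> 'a rel \<Rightarrow> 'a set \<Rightarrow> ('a \<Rightarrow> int) set"
  where "connected_configs m r B = {x \<in> B \<rightarrow>\<^sub>E {0..}. 0 \<in> x ` B \<and>
    (\<forall>u\<in>B. \<forall>v\<in>B. (u, v) \<in> {(a, b). a \<in> B \<and> b \<in> B \<and> shi_adj m r x a b}\<^sup>*)}"

definition before :: "'a rel \<Rightarrow> ('a \<Rightarrow> int) \<Rightarrow> 'a \<Rightarrow> 'a \<Rightarrow> bool"
  where "before r x u v \<longleftrightarrow> x u < x v \<or> x u = x v \<and> lt_of r u v"

definition near :: "nat \<Rightarrow> 'a rel \<Rightarrow> ('a \<Rightarrow> int) \<Rightarrow> 'a \<Rightarrow> 'a \<Rightarrow> bool"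
  where "near m r x u v \<longleftrightarrow> before r x u v \<and> shi_adj m r x u v"

lemma near_cong: "x u = y u \<Longrightarrow> x v = y v \<Longrightarrow> near m r x u v \<longleftrightarrow> near m r y u v"
  by (simp add: near_def before_def shi_adj_def)

lemma shi_adj_sym: "shi_adj m r x u v \<longleftrightarrow> shi_adj m r x v u"
  by (auto simp: shi_adj_def)

lemma fin_linorder_lt_of_cases:
  assumes "fin_linorder V r" "u \<in> V" "v \<in> V" "u \<noteq> v"
  obtains "lt_of r u v" "\<not> lt_of r v u" | "lt_of r v u" "\<not> lt_of r u v"
  using fin_linorder_lt_of[OF assms(1)] assms(2-4)
  by (metis irreflp_onD totalp_onD transp_onD)

text \<open>
  The reason for breaking ties by increasing label: whichever of \<open>u\<close>, \<open>v\<close> has the larger label,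
  there are exactly \<open>m\<close> positions that make \<open>v\<close> come after \<open>u\<close> and adjacent to it.
\<close>

lemma near_iff:
  assumes "fin_linorder V r" "u \<in> V" "v \<in> V" "u \<noteq> v"
  shows "near m r x u v \<longleftrightarrow> x v - x u - of_bool (lt_of r v u) \<in> {0..<int m}"
  using assms(1-4)
  by (cases rule: fin_linorder_lt_of_cases) (auto simp: near_def before_def shi_adj_def)

lemma before_linear:
  assumes "fin_linorder V r"
  shows "irreflp_on V (before r x)" "transp_on V (before r x)" "totalp_on V (before r x)"
proof -
  note lt = fin_linorder_lt_of[OF assms]
  show "irreflp_on V (before r x)"
    using lt(1) by (auto simp: before_def irreflp_on_def)
  show "transp_on V (before r x)"
  proof (rule transp_onI)
    fix u v w assume "u \<in> V" "v \<in> V" "w \<in> V" "before r x u v" "before r x v w"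
    then show "before r x u w"
      using transp_onD[OF lt(2), of u v w] by (auto simp: before_def)
  qed
  show "totalp_on V (before r x)"
  proof (rule totalp_onI)
    fix u v assume "u \<in> V" "v \<in> V" "u \<noteq> v"
    then show "before r x u v \<or> before r x v u"
      using totalp_onD[OF lt(3), of u v] by (auto simp: before_def)
  qed
qed

text \<open>The list \<open>ws\<close> runs from right to left, so that its last element is the one at \<open>0\<close>.\<close>

definition chain_configs :: "nat \<Rightarrow> 'a rel \<Rightarrow> 'a list \<Rightarrow> ('a \<Rightarrow> int) set"
  where "chain_configs m r ws = {x \<in> extensional (set ws). x (last ws) = 0 \<and>
    successively (\<lambda>v u. near m r x u v) ws}"

text \<open>
  Appending a new rightmost element \<open>v\<close> to a chain that ends in \<open>u\<close> leaves \<open>m\<close> positions for \<open>v\<close>,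
  whatever the labels of \<open>u\<close> and \<open>v\<close> are.
\<close>

lemma card_chain_configs:
  assumes V: "fin_linorder V r" and "distinct ws" "ws \<noteq> []" "set ws \<subseteq> V"
  shows "finite (chain_configs m r ws) \<and> card (chain_configs m r ws) = m ^ (length ws - 1)"
  using assms(2-4)
proof (induction ws rule: induct_list012)
  case 1
  then show ?case by simp
next
  case (2 u)
  have "chain_configs m r [u] = {\<lambda>v\<in>{u}. 0}"
    by (auto simp: chain_configs_def extensional_def)
  then show ?case by simp
next
  case (3 v u ws)
  let ?C = "chain_configs m r"
  define f where "f = (\<lambda>(y, d). y(v := y u + d + of_bool (lt_of r v u)) :: 'a \<Rightarrow> int)"
  have v: "v \<notin> set (u # ws)" "u \<noteq> v" "u \<in> V" "v \<in> V"
    using 3 by auto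
  have near: "near m r x u v \<longleftrightarrow> x v - x u - of_bool (lt_of r v u) \<in> {0..<int m}" for x
    using near_iff[OF V v(3,4,2)] .
  have succ: "successively (\<lambda>b a. near m r (y(v := c)) a b) (u # ws) \<longleftrightarrow>
      successively (\<lambda>b a. near m r y a b) (u # ws)" for y c
    by (rule successively_cong) (use v in \<open>auto intro!: near_cong\<close>)
  have succ': "successively (\<lambda>b a. near m r (restrict x (set (u # ws))) a b) (u # ws) \<longleftrightarrow>
      successively (\<lambda>v u. near m r x u v) (u # ws)" for x
    by (rule successively_cong) ((rule near_cong; simp), rule refl)
  have bij: "bij_betw f (?C (u # ws) \<times> {0..<int m}) (?C (v # u # ws))"
  proof (rule bij_betw_byWitness[where f' =
        "\<lambda>x. (restrict x (set (u # ws)), x v - x u - of_bool (lt_of r v u))"])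
    show "\<forall>p\<in>?C (u # ws) \<times> {0..<int m}.
        (restrict (f p) (set (u # ws)), f p v - f p u - of_bool (lt_of r v u)) = p"
    proof (clarify, intro conjI)
      fix y d assume y: "y \<in> ?C (u # ws)"
      show "restrict (f (y, d)) (set (u # ws)) = y"
      proof
        fix w
        show "restrict (f (y, d)) (set (u # ws)) w = y w"
          using y v by (auto simp: f_def chain_configs_def restrict_def extensional_def)
      qed
      show "f (y, d) v - f (y, d) u - of_bool (lt_of r v u) = d"
        using v by (simp add: f_def)
    qed
    show "\<forall>x\<in>?C (v # u # ws).
        f (restrict x (set (u # ws)), x v - x u - of_bool (lt_of r v u)) = x"
    proof
      fix x assume x: "x \<in> ?C (v # u # ws)"
      show "f (restrict x (set (u # ws)), x v - x u - of_bool (lt_of r v u)) = x"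
      proof
        fix w
        show "f (restrict x (set (u # ws)), x v - x u - of_bool (lt_of r v u)) w = x w"
          using x by (auto simp: f_def chain_configs_def restrict_def extensional_def)
      qed
    qed
    show "f ` (?C (u # ws) \<times> {0..<int m}) \<subseteq> ?C (v # u # ws)"
    proof
      fix x assume "x \<in> f ` (?C (u # ws) \<times> {0..<int m})"
      then obtain y d where y: "y \<in> ?C (u # ws)" and d: "d \<in> {0..<int m}" and x: "x = f (y, d)"
        by blast
      have x: "x = y(v := y u + d + of_bool (lt_of r v u))"
        by (simp add: x f_def)
      have "last (u # ws) \<noteq> v"
        using v(1) last_in_set[of "u # ws"] by auto
      then have "x (last (v # u # ws)) = 0"
        using y by (simp add: x chain_configs_def)
      moreover have "x \<in> extensional (set (v # u # ws))"
        using y by (auto simp: x chain_configs_def extensional_def)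
      moreover have "near m r x u v"
        unfolding near using d v by (simp add: x)
      moreover have "successively (\<lambda>v u. near m r x u v) (u # ws)"
        unfolding x succ using y by (simp add: chain_configs_def)
      ultimately show "x \<in> ?C (v # u # ws)"
        by (simp add: chain_configs_def)
    qed
    show "(\<lambda>x. (restrict x (set (u # ws)), x v - x u - of_bool (lt_of r v u))) ` ?C (v # u # ws)
        \<subseteq> ?C (u # ws) \<times> {0..<int m}"
    proof clarify
      fix x assume "x \<in> ?C (v # u # ws)"
      then have x: "x (last (u # ws)) = 0" "near m r x u v"
        "successively (\<lambda>v u. near m r x u v) (u # ws)"
        by (simp_all add: chain_configs_def)
      have "restrict x (set (u # ws)) (last (u # ws)) = 0"
        using x(1) last_in_set[of "u # ws"] by simp
      then have "restrict x (set (u # ws)) \<in> ?C (u # ws)"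
        unfolding chain_configs_def using x(3)
        by (simp only: mem_Collect_eq succ' restrict_extensional simp_thms)
      moreover have "x v - x u - of_bool (lt_of r v u) \<in> {0..<int m}"
        using x(2) unfolding near .
      ultimately show "restrict x (set (u # ws)) \<in> ?C (u # ws) \<and>
          x v - x u - of_bool (lt_of r v u) \<in> {0..<int m}"
        by (rule conjI)
    qed
  qed
  have IH: "finite (?C (u # ws))" "card (?C (u # ws)) = m ^ (length (u # ws) - 1)"
    using 3 by auto
  have "finite (?C (v # u # ws))"
    using bij_betw_finite[OF bij] IH(1) by simp
  moreover have "card (?C (v # u # ws)) = m ^ (length (u # ws) - 1) * m"
    using bij_betw_same_card[OF bij, symmetric] IH(2) by (simp add: card_cartesian_product)
  ultimately show ?case by simp
qed

lemma rtrancl_leaves_set: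
  assumes "(u, v) \<in> R\<^sup>*" "u \<in> A" "v \<notin> A"
  shows "\<exists>a b. (a, b) \<in> R \<and> a \<in> A \<and> b \<notin> A"
  using assms by (induction rule: converse_rtrancl_induct) blast+

text \<open>
  The edge from \<open>a\<close> to \<open>b\<close> spans a range of positions containing both \<open>u\<close> and \<open>v\<close>. It is
  longer than allowed for the pair \<open>u\<close>, \<open>v\<close> only if the endpoints are in the same positions
  as \<open>u\<close> and \<open>v\<close> and have descending labels, but ties are ordered by increasing label.
\<close>

lemma near_if_spanned:
  assumes V: "fin_linorder V r" and in_V: "a \<in> V" "u \<in> V" "v \<in> V" "b \<in> V"
    and au: "a = u \<or> before r x a u" and uv: "before r x u v" and vb: "v = b \<or> before r x v b"
    and adj: "shi_adj m r x a b"
  shows "near m r x u v"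
proof -
  have tr: "transp_on V (before r x)" and irr: "irreflp_on V (before r x)"
    using before_linear[OF V] by blast+
  have lt_trans: "lt_of r p q \<Longrightarrow> lt_of r q s \<Longrightarrow> p \<in> V \<Longrightarrow> q \<in> V \<Longrightarrow> s \<in> V \<Longrightarrow> lt_of r p s"
    for p q s
    using transp_onD[OF fin_linorder_lt_of(2)[OF V]] by blast
  have ab: "before r x a b"
    using au uv vb in_V tr by (metis transp_onD)
  have ne: "u \<noteq> v" "a \<noteq> b"
    using irr uv ab in_V by (metis irreflp_onD)+
  have pos: "x a \<le> x u" "x u \<le> x v" "x v \<le> x b"
    using au uv vb by (auto simp: before_def)
  have gap: "x b - x a - of_bool (lt_of r b a) \<in> {0..<int m}"
    using ab adj near_iff[OF V in_V(1,4) ne(2), of m x] by (simp only: near_def simp_thms)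
  have uv_gap: "0 \<le> x v - x u - of_bool (lt_of r v u)"
    using V in_V(2,3) ne(1) by (cases rule: fin_linorder_lt_of_cases) (use uv in \<open>auto simp: before_def\<close>)
  show ?thesis
  proof (cases "lt_of r v u \<or> \<not> lt_of r b a \<or> x v - x u < x b - x a")
    case True
    then have "x v - x u - of_bool (lt_of r v u) < int m"
      using gap pos by (auto simp: of_bool_def split: if_splits)
    then show ?thesis
      using near_iff[OF V in_V(2,3) ne(1)] uv_gap by simp
  next
    case False
    then have "x a = x u" "x v = x b" "lt_of r b a" "lt_of r u v"
      using pos V in_V(2,3) ne(1) by (auto elim: fin_linorder_lt_of_cases)
    then have "a = u \<or> lt_of r a u" "v = b \<or> lt_of r v b"
      using au vb by (auto simp: before_def)
    then have "lt_of r a b"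
      using lt_trans in_V \<open>lt_of r u v\<close> by metis
    then have False
      using lt_trans[OF \<open>lt_of r a b\<close> \<open>lt_of r b a\<close>] in_V by (simp add: lt_of_def)
    then show ?thesis ..
  qed
qed

text \<open>
  In a connected configuration some edge crosses the gap between any two elements that are
  consecutive in the order by position and label, and this makes the two elements adjacent.
  Conversely, a chain of adjacent elements is connected. The chain can be recovered from the
  configuration by sorting, so that the union is disjoint.
\<close>

lemma connected_configs_eq_UN_chain_configs:
  assumes V: "fin_linorder V r" and B: "B \<subseteq> V" "B \<noteq> {}"
  shows "connected_configs m r B = (\<Union>ws\<in>permutations_of_set B. chain_configs m r ws)"
proof (intro equalityI subsetI)
  fix x assume "x \<in> (\<Union>ws\<in>permutations_of_set B. chain_configs m r ws)"
  then obtain ws where ws: "set ws = B" "distinct ws" and x: "x \<in> extensional B" "x (last ws) = 0"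
    and succ: "successively (\<lambda>v u. near m r x u v) ws"
    by (auto simp: permutations_of_set_def chain_configs_def)
  have last: "last ws \<in> B"
    using ws B last_in_set[of ws] by auto
  let ?R = "{(a, b). a \<in> B \<and> b \<in> B \<and> shi_adj m r x a b}"
  have "0 \<le> x u \<and> (u, last ws) \<in> ?R\<^sup>*" if "u \<in> set ws" for u
    using succ that x(2) eq_refl[OF ws(1)]
  proof (induction ws arbitrary: u rule: induct_list012)
    case (3 v u' ws)
    then have IH: "0 \<le> x w \<and> (w, last (u' # ws)) \<in> ?R\<^sup>*" if "w \<in> set (u' # ws)" for w
      using that by auto
    have "near m r x u' v" "u' \<in> B" "v \<in> B"
      using "3.prems" by auto
    then have "(v, u') \<in> ?R" "x u' \<le> x v"
      by (auto simp: near_def before_def shi_adj_sym[of m r x v])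
    then have "0 \<le> x v \<and> (v, last (v # u' # ws)) \<in> ?R\<^sup>*"
      using IH[of u'] by (auto intro: converse_rtrancl_into_rtrancl)
    then show ?case
      using IH "3.prems"(2) by auto
  qed auto
  then have low: "0 \<le> x u" "(u, last ws) \<in> ?R\<^sup>*" if "u \<in> B" for u
    using that ws by blast+
  have "sym ?R"
    by (auto intro!: symI intro: iffD1[OF shi_adj_sym])
  then have "(u, v) \<in> ?R\<^sup>*" if "u \<in> B" "v \<in> B" for u v
    using low(2) that by (meson rtrancl_trans sym_rtrancl symD)
  then show "x \<in> connected_configs m r B"
    using x low(1) last unfolding connected_configs_def by (force simp: PiE_iff)
next
  fix x assume x: "x \<in> connected_configs m r B"
  let ?R = "{(a, b). a \<in> B \<and> b \<in> B \<and> shi_adj m r x a b}"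
  have conn: "(u, v) \<in> ?R\<^sup>*" if "u \<in> B" "v \<in> B" for u v
    using x that by (auto simp: connected_configs_def)
  have "finite B"
    using V B finite_subset by (auto simp: fin_linorder_def)
  moreover have "irreflp_on B (before r x)" "transp_on B (before r x)" "totalp_on B (before r x)"
    using before_linear[OF V] B(1)
    by (blast intro: irreflp_on_subset transp_on_subset totalp_on_subset)+
  ultimately obtain us where us: "set us = B" "sorted_wrt (before r x) us"
    using ex1_sorted_wrt by metis
  define ws where "ws = rev us"
  have ws: "set ws = B" "sorted_wrt (\<lambda>v u. before r x u v) ws"
    using us by (simp_all add: ws_def sorted_wrt_rev)
  have before: "before r x (ws ! j) (ws ! i)" if "i < j" "j < length ws" for i j
    using sorted_wrt_nth_less[OF ws(2) that] .
  have "\<not> before r x u u" if "u \<in> B" for u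
    using before_linear(1)[OF V] that B by (meson irreflp_onD subsetD)
  then have "distinct ws"
    unfolding distinct_conv_nth using before ws(1) by (metis nat_neq_iff nth_mem)
  have "ws \<noteq> []"
    using ws B by auto
  have "near m r x (ws ! Suc i) (ws ! i)" if i: "Suc i < length ws" for i
  proof -
    \<comment> \<open>\<open>A\<close> is the part to the left of the gap between \<open>ws ! Suc i\<close> and \<open>ws ! i\<close>.\<close>
    define A where "A = {ws ! j | j. i < j \<and> j < length ws}"
    have nth_A: "ws ! j \<in> A \<longleftrightarrow> i < j" if "j < length ws" for j
      using that \<open>distinct ws\<close> by (auto simp: A_def nth_eq_iff_index_eq)
    have "ws ! Suc i \<in> A" "ws ! i \<notin> A"
      using i nth_A by auto
    moreover have "(ws ! Suc i, ws ! i) \<in> ?R\<^sup>*"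
      using i ws(1) by (intro conn) auto
    ultimately have "\<exists>a b. (a, b) \<in> ?R \<and> a \<in> A \<and> b \<notin> A"
      by (intro rtrancl_leaves_set)
    then obtain a b where ab: "(a, b) \<in> ?R" "a \<in> A" "b \<notin> A"
      by blast
    then obtain j k where j: "a = ws ! j" "j < length ws" and k: "b = ws ! k" "k < length ws"
      using ws(1) by (auto simp: in_set_conv_nth)
    have "i < j" "\<not> i < k"
      using ab nth_A j k by auto
    then have "a = ws ! Suc i \<or> before r x a (ws ! Suc i)" "ws ! i = b \<or> before r x (ws ! i) b"
      using before[of "Suc i" j] before[of k i] i j k 
      by (cases "j = Suc i"; cases "k = i"; force)+
    then show ?thesis
      using ab i B(1) ws(1) before[of i "Suc i"]
      by (intro near_if_spanned[OF V, of a "ws ! Suc i" "ws ! i" b]) auto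
  qed
  then have "successively (\<lambda>v u. near m r x u v) ws"
    by (simp add: successively_conv_nth)
  moreover have "x (last ws) = 0"
  proof -
    from x obtain u where u: "u \<in> B" "x u = 0"
      by (auto simp: connected_configs_def)
    then obtain i where i: "i < length ws" "u = ws ! i"
      using ws(1) by (auto simp: in_set_conv_nth)
    have "last ws = ws ! (length ws - 1)"
      using \<open>ws \<noteq> []\<close> by (rule last_conv_nth)
    then have "last ws = u \<or> before r x (last ws) u"
      using before[of i "length ws - 1"] i by (cases "i = length ws - 1") auto
    then have "x (last ws) \<le> 0"
      using u by (auto simp: before_def)
    moreover have "x (last ws) \<ge> 0"
      using x \<open>ws \<noteq> []\<close> ws(1) last_in_set[of ws] by (auto simp: connected_configs_def PiE_iff)
    ultimately show ?thesis by simp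
  qed
  ultimately show "x \<in> (\<Union>ws\<in>permutations_of_set B. chain_configs m r ws)"
    using x ws(1) \<open>distinct ws\<close>
    by (auto simp: permutations_of_set_def chain_configs_def connected_configs_def PiE_iff)
qed

lemma sorted_wrt_before_if_chain_config:
  assumes V: "fin_linorder V r" and "set ws \<subseteq> V" "x \<in> chain_configs m r ws"
  shows "sorted_wrt (\<lambda>v u. before r x u v) ws"
proof -
  have "successively (\<lambda>v u. before r x u v) ws"
    using assms(3) by (auto simp: chain_configs_def near_def intro: successively_mono)
  then show ?thesis
    using assms(2) transp_onD[OF before_linear(2)[OF V, of x]]
    by (subst (asm) successively_iff_sorted_wrt_strong) blast+
qed

theorem card_connected_configs:
  assumes V: "fin_linorder V r" and B: "B \<subseteq> V" "B \<noteq> {}"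
  shows "finite (connected_configs m r B)"
    and "card (connected_configs m r B) = fact (card B) * m ^ (card B - 1)"
proof -
  have "finite B"
    using V B finite_subset by (auto simp: fin_linorder_def)
  then have fin: "finite (permutations_of_set B)"
    by simp
  have chain: "finite (chain_configs m r ws) \<and> card (chain_configs m r ws) = m ^ (card B - 1)"
    if "ws \<in> permutations_of_set B" for ws
  proof -
    have "set ws = B" "distinct ws" "length ws = card B" "ws \<noteq> []"
      using that B distinct_card by (fastforce simp: permutations_of_set_def)+
    then show ?thesis
      using card_chain_configs[OF V, of ws m] B(1) by auto
  qed
  show "finite (connected_configs m r B)"
    unfolding connected_configs_eq_UN_chain_configs[OF V B] using fin chain by blast
  have disj: "chain_configs m r ws \<inter> chain_configs m r ws' = {}"
    if ws: "ws \<in> permutations_of_set B" "ws' \<in> permutations_of_set B" "ws \<noteq> ws'" for ws ws'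
  proof (rule ccontr)
    assume "chain_configs m r ws \<inter> chain_configs m r ws' \<noteq> {}"
    then obtain x where x: "x \<in> chain_configs m r ws" "x \<in> chain_configs m r ws'"
      by blast
    have *: "irreflp_on B (before r x)" "transp_on B (before r x)" "totalp_on B (before r x)"
      using before_linear[OF V] B(1)
      by (blast intro: irreflp_on_subset transp_on_subset totalp_on_subset)+
    have "set (rev ws) = B" "set (rev ws') = B"
      using ws by (simp_all add: permutations_of_set_def)
    moreover have "sorted_wrt (before r x) (rev ws)" "sorted_wrt (before r x) (rev ws')"
      using sorted_wrt_before_if_chain_config[OF V] x ws B(1)
      by (simp_all add: permutations_of_set_def sorted_wrt_rev)
    ultimately have "rev ws = rev ws'"
      using ex1_sorted_wrt[OF \<open>finite B\<close> *] by blast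
    with ws(3) show False by simp
  qed
  have "card (connected_configs m r B) =
      (\<Sum>ws\<in>permutations_of_set B. card (chain_configs m r ws))"
    unfolding connected_configs_eq_UN_chain_configs[OF V B]
    using fin chain disj by (intro card_UN_disjoint) auto
  also have "\<dots> = fact (card B) * m ^ (card B - 1)"
    using chain \<open>finite B\<close> by simp
  finally show "card (connected_configs m r B) = fact (card B) * m ^ (card B - 1)" .
qed


section \<open>Relabelling flats\<close>

lemma coord_space_iff: "x \<in> coord_space V \<longleftrightarrow> (\<forall>u. u \<notin> V \<longrightarrow> Poly_Mapping.lookup x u = 0)"
  by (auto simp: coord_space_def in_keys_iff)

lemma coord_space_eqI:
  assumes "x \<in> coord_space V" "y \<in> coord_space V"
    and "\<And>v. v \<in> V \<Longrightarrow> Poly_Mapping.lookup x v = Poly_Mapping.lookup y v"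
  shows "x = y"
  using assms by (metis coord_space_iff poly_mapping_eqI)

lemma lookup_scaleR: "Poly_Mapping.lookup (c *\<^sub>R x) u = c * Poly_Mapping.lookup x u"
  for x :: "'a \<Rightarrow>\<^sub>0 real"
proof -
  have "finite {i. c *\<^sub>R Poly_Mapping.lookup x i \<noteq> 0}"
    by (rule finite_subset[OF _ finite_lookup[of x]]) auto
  then show ?thesis
    by (simp add: scaleR_poly_mapping_def)
qed

lemma subspace_coord_space: "subspace (coord_space V)"
  by (auto simp: subspace_def coord_space_iff lookup_add lookup_scaleR)

definition vec_on :: "'a set \<Rightarrow> ('a \<Rightarrow> real) \<Rightarrow> ('a \<Rightarrow>\<^sub>0 real)"
  where "vec_on V f = Abs_poly_mapping (\<lambda>u. if u \<in> V then f u else 0)"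

lemma lookup_vec_on:
  assumes "finite V"
  shows "Poly_Mapping.lookup (vec_on V f) u = (if u \<in> V then f u else 0)"
proof -
  have "finite {u. (if u \<in> V then f u else 0) \<noteq> 0}"
    by (rule finite_subset[OF _ assms]) auto
  then show ?thesis
    by (simp add: vec_on_def)
qed

lemma vec_on_in_coord_space: "finite V \<Longrightarrow> vec_on V f \<in> coord_space V"
  by (simp add: coord_space_iff lookup_vec_on)

definition pull_back :: "'a set \<Rightarrow> ('a \<Rightarrow> 'a) \<Rightarrow> ('a \<Rightarrow>\<^sub>0 real) \<Rightarrow> ('a \<Rightarrow>\<^sub>0 real)"
  where "pull_back V \<sigma> y = vec_on V (\<lambda>v. Poly_Mapping.lookup y (\<sigma> v))"

lemma lookup_pull_back:
  "finite V \<Longrightarrow> Poly_Mapping.lookup (pull_back V \<sigma> y) u =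
    (if u \<in> V then Poly_Mapping.lookup y (\<sigma> u) else 0)"
  by (simp add: pull_back_def lookup_vec_on)

lemma pull_back_in_coord_space: "finite V \<Longrightarrow> pull_back V \<sigma> y \<in> coord_space V"
  by (simp add: pull_back_def vec_on_in_coord_space)

text \<open>
  Relabelling is a preimage under a linear map. Hence it commutes with intersections, and it is
  functorial because pulling back along \<open>\<tau> \<circ> \<sigma>\<close> is pulling back along \<open>\<tau>\<close> and then along \<open>\<sigma>\<close>.
\<close>

lemma relabel_flat_eq_vimage:
  assumes V: "finite V" and X: "X \<subseteq> coord_space V"
  shows "relabel_flat V \<sigma> X = {y \<in> coord_space (\<sigma> ` V). pull_back V \<sigma> y \<in> X}"
proof -
  have "(\<exists>x\<in>X. \<forall>v\<in>V. Poly_Mapping.lookup y (\<sigma> v) = Poly_Mapping.lookup x v) \<longleftrightarrow>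
      pull_back V \<sigma> y \<in> X" for y
  proof
    assume "\<exists>x\<in>X. \<forall>v\<in>V. Poly_Mapping.lookup y (\<sigma> v) = Poly_Mapping.lookup x v"
    then obtain x where x: "x \<in> X"
      "\<forall>v\<in>V. Poly_Mapping.lookup y (\<sigma> v) = Poly_Mapping.lookup x v" by blast
    have "pull_back V \<sigma> y = x"
      by (rule coord_space_eqI[of _ V])
        (use x X V in \<open>auto simp: pull_back_in_coord_space lookup_pull_back\<close>)
    then show "pull_back V \<sigma> y \<in> X" using x(1) by simp
  next
    assume "pull_back V \<sigma> y \<in> X"
    then show "\<exists>x\<in>X. \<forall>v\<in>V. Poly_Mapping.lookup y (\<sigma> v) = Poly_Mapping.lookup x v"
      using V by (intro bexI[of _ "pull_back V \<sigma> y"]) (simp_all add: lookup_pull_back)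
  qed
  then show ?thesis
    by (simp add: relabel_flat_def)
qed

lemma linear_pull_back: "finite V \<Longrightarrow> linear (pull_back V \<sigma>)"
  by (rule linearI) (auto intro!: poly_mapping_eqI simp: lookup_pull_back lookup_add lookup_scaleR)

lemma pull_back_inj_on:
  assumes "finite V"
  shows "inj_on (pull_back V \<sigma>) (coord_space (\<sigma> ` V))"
proof (rule inj_onI)
  fix y z
  assume yz: "y \<in> coord_space (\<sigma> ` V)" "z \<in> coord_space (\<sigma> ` V)"
    and eq: "pull_back V \<sigma> y = pull_back V \<sigma> z"
  have "Poly_Mapping.lookup y (\<sigma> v) = Poly_Mapping.lookup z (\<sigma> v)" if "v \<in> V" for v
    using lookup_pull_back[OF assms, of \<sigma> y v] lookup_pull_back[OF assms, of \<sigma> z v] eq that by simp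
  then show "y = z"
    by (intro coord_space_eqI[OF yz]) auto
qed

lemma pull_back_image_relabel_flat:
  assumes V: "finite V" and \<sigma>: "inj_on \<sigma> V" and X: "X \<subseteq> coord_space V"
  shows "pull_back V \<sigma> ` relabel_flat V \<sigma> X = X"
proof
  show "pull_back V \<sigma> ` relabel_flat V \<sigma> X \<subseteq> X"
    by (auto simp: relabel_flat_eq_vimage[OF V X])
  show "X \<subseteq> pull_back V \<sigma> ` relabel_flat V \<sigma> X"
  proof
    fix x assume x: "x \<in> X"
    define y where "y = vec_on (\<sigma> ` V) (\<lambda>w. Poly_Mapping.lookup x (inv_into V \<sigma> w))"
    have "y \<in> coord_space (\<sigma> ` V)"
      using V by (simp add: y_def vec_on_in_coord_space)
    moreover have "pull_back V \<sigma> y = x"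
      by (rule coord_space_eqI[of _ V])
        (use x X V \<sigma> in \<open>auto simp: pull_back_in_coord_space lookup_pull_back y_def lookup_vec_on
          inv_into_f_f\<close>)
    ultimately show "x \<in> pull_back V \<sigma> ` relabel_flat V \<sigma> X"
      using x by (auto simp: relabel_flat_eq_vimage[OF V X] intro!: image_eqI[of x _ y])
  qed
qed

text \<open>
  A basis of \<open>S\<close> is mapped to a basis of its image. The map is meant to be a relabelling between
  spaces of all finitely supported functions, which may have infinite dimension.
\<close>

lemma dim_linear_image:
  fixes f :: "'a::real_vector \<Rightarrow> 'b::real_vector"
  assumes f: "linear f" and inj: "inj_on f (span S)"
  shows "dim (f ` S) = dim S"
proof -
  obtain B where B: "B \<subseteq> S" "independent B" "S \<subseteq> span B" "card B = dim S"
    by (rule basis_exists)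
  have span: "span B \<subseteq> span S"
    using B(1) by (rule span_mono)
  have inj_B: "inj_on f (span B)"
    using inj span by (rule inj_on_subset)
  have "f ` S \<subseteq> span (f ` B)"
    using B(3) linear_span_image[OF f, of B] by blast
  moreover have "independent (f ` B)"
    using linear_independent_injective_image[OF f B(2) inj_B] .
  moreover have "card (f ` B) = card B"
    using inj_on_subset[OF inj_B span_superset] by (rule card_image)
  ultimately show ?thesis
    using B(1,4) by (intro dim_unique[of "f ` B"]) auto
qed

lemma flat_dim_relabel_flat:
  assumes V: "finite V" and \<sigma>: "inj_on \<sigma> V" and X: "X \<subseteq> coord_space V"
  shows "flat_dim (relabel_flat V \<sigma> X) = flat_dim X"
proof -
  let ?Y = "relabel_flat V \<sigma> X" and ?f = "pull_back V \<sigma>"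
  have Y: "?Y \<subseteq> coord_space (\<sigma> ` V)"
    by (auto simp: relabel_flat_def)
  have f: "linear ?f"
    using V by (rule linear_pull_back)
  have image: "{x - y | x y. x \<in> ?f ` ?Y \<and> y \<in> ?f ` ?Y} = ?f ` {x - y | x y. x \<in> ?Y \<and> y \<in> ?Y}"
    using linear_diff[OF f] by (auto 4 4 simp: image_def)
  have "span {x - y | x y. x \<in> ?Y \<and> y \<in> ?Y} \<subseteq> coord_space (\<sigma> ` V)"
    using Y subspace_coord_space[of "\<sigma> ` V"] by (intro span_minimal) (auto intro: subspace_diff)
  then have inj: "inj_on ?f (span {x - y | x y. x \<in> ?Y \<and> y \<in> ?Y})"
    using pull_back_inj_on[OF V] inj_on_subset by blast
  have "flat_dim X = flat_dim (?f ` ?Y)"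
    unfolding pull_back_image_relabel_flat[OF assms] ..
  also have "\<dots> = flat_dim ?Y"
    unfolding flat_dim_def image by (rule dim_linear_image[OF f inj])
  finally show ?thesis ..
qed

lemma flats_subset_coord_space: "X \<in> flats V \<A> \<Longrightarrow> X \<subseteq> coord_space V"
  by (auto simp: flats_def)

lemma relabel_flat_Int_Inter:
  assumes V: "finite V" and H: "\<And>H. H \<in> \<H> \<Longrightarrow> H \<subseteq> coord_space V"
  shows "relabel_flat V \<sigma> (coord_space V \<inter> \<Inter>\<H>) =
    coord_space (\<sigma> ` V) \<inter> \<Inter>(relabel_flat V \<sigma> ` \<H>)"
  using relabel_flat_eq_vimage[OF V Int_lower1, of \<sigma> "\<Inter>\<H>"] relabel_flat_eq_vimage[OF V H, of _ \<sigma>]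
    pull_back_in_coord_space[OF V]
  by auto

lemma relabel_flat_hyperplane:
  assumes V: "finite V" and uv: "u \<in> V" "v \<in> V"
  shows "relabel_flat V \<sigma> {x \<in> coord_space V. Poly_Mapping.lookup x u - Poly_Mapping.lookup x v = a} =
    {x \<in> coord_space (\<sigma> ` V). Poly_Mapping.lookup x (\<sigma> u) - Poly_Mapping.lookup x (\<sigma> v) = a}"
  using uv pull_back_in_coord_space[OF V]
  by (subst relabel_flat_eq_vimage[OF V]) (auto simp: lookup_pull_back[OF V])

lemma shi_arrangement_subset_coord_space: "H \<in> shi_arrangement m V r \<Longrightarrow> H \<subseteq> coord_space V"
  by (auto simp: shi_arrangement_def)

lemma finite_shi_arrangement:
  assumes "finite V"
  shows "finite (shi_arrangement m V r)"
proof -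
  have "shi_arrangement m V r \<subseteq> (\<lambda>(u, v, a). {x \<in> coord_space V.
      Poly_Mapping.lookup x u - Poly_Mapping.lookup x v = of_int a}) ` (V \<times> V \<times> {1 - int m..int m})"
  proof
    fix H assume "H \<in> shi_arrangement m V r"
    then obtain u v a where "u \<in> V" "v \<in> V" "1 - int m \<le> a" "a \<le> int m"
      "H = {x \<in> coord_space V. Poly_Mapping.lookup x u - Poly_Mapping.lookup x v = of_int a}"
      by (auto simp: shi_arrangement_def)
    then show "H \<in> (\<lambda>(u, v, a). {x \<in> coord_space V.
      Poly_Mapping.lookup x u - Poly_Mapping.lookup x v = of_int a}) ` (V \<times> V \<times> {1 - int m..int m})"
      by (intro image_eqI[of _ _ "(u, v, a)"]) auto
  qed
  then show ?thesis
    by (rule finite_subset) (use assms in simp)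
qed

lemma finite_flats:
  assumes "finite \<A>"
  shows "finite (flats V \<A>)"
proof -
  have "flats V \<A> \<subseteq> (\<lambda>\<H>. coord_space V \<inter> \<Inter>\<H>) ` Pow \<A>"
    by (auto simp: flats_def)
  then show ?thesis
    by (rule finite_subset) (use assms in simp)
qed

lemma relabel_flat_in_flats:
  assumes \<sigma>: "order_bij V r W s \<sigma>" and X: "X \<in> flats V (shi_arrangement m V r)"
  shows "relabel_flat V \<sigma> X \<in> flats W (shi_arrangement m W s)"
proof -
  have V: "finite V" and inj: "inj_on \<sigma> V" and W: "\<sigma> ` V = W"
    and mono: "\<And>u v. u \<in> V \<Longrightarrow> v \<in> V \<Longrightarrow> (u, v) \<in> r \<Longrightarrow> (\<sigma> u, \<sigma> v) \<in> s"
    using \<sigma> by (auto simp: order_bij_def fin_linorder_def bij_betw_def)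
  obtain \<H> where H: "\<H> \<subseteq> shi_arrangement m V r" "X = coord_space V \<inter> \<Inter>\<H>"
    using X by (auto simp: flats_def)
  have "relabel_flat V \<sigma> X = coord_space W \<inter> \<Inter>(relabel_flat V \<sigma> ` \<H>)"
    unfolding H(2) W[symmetric]
    using H(1) shi_arrangement_subset_coord_space by (intro relabel_flat_Int_Inter[OF V]) blast
  moreover have "relabel_flat V \<sigma> ` \<H> \<subseteq> shi_arrangement m W s"
  proof
    fix K assume "K \<in> relabel_flat V \<sigma> ` \<H>"
    then obtain H where "H \<in> shi_arrangement m V r" "K = relabel_flat V \<sigma> H"
      using H(1) by blast
    then obtain u v a where *: "u \<in> V" "v \<in> V" "u \<noteq> v" "(u, v) \<in> r" "1 - int m \<le> a" "a \<le> int m"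
      and K: "K = relabel_flat V \<sigma>
        {x \<in> coord_space V. Poly_Mapping.lookup x u - Poly_Mapping.lookup x v = of_int a}"
      by (auto simp: shi_arrangement_def)
    have "K = {x \<in> coord_space W.
        Poly_Mapping.lookup x (\<sigma> u) - Poly_Mapping.lookup x (\<sigma> v) = of_int a}"
      unfolding K relabel_flat_hyperplane[OF V *(1,2)] W ..
    moreover have "\<sigma> u \<in> W" "\<sigma> v \<in> W" "\<sigma> u \<noteq> \<sigma> v" "(\<sigma> u, \<sigma> v) \<in> s"
      using * W inj mono by (auto dest: inj_onD)
    ultimately show "K \<in> shi_arrangement m W s"
      using *(5,6) unfolding shi_arrangement_def by blast
  qed
  moreover have "relabel_flat V \<sigma> X \<noteq> {}"
    using pull_back_image_relabel_flat[OF V inj flats_subset_coord_space[OF X]] X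
    by (auto simp: flats_def)
  ultimately show ?thesis
    unfolding flats_def by blast
qed

lemma relabel_flat_id:
  assumes "finite V" "X \<subseteq> coord_space V"
  shows "relabel_flat V id X = X"
proof -
  have "pull_back V id x = x" if "x \<in> coord_space V" for x
    by (rule coord_space_eqI[OF _ that])
      (use assms(1) in \<open>simp_all add: pull_back_in_coord_space lookup_pull_back\<close>)
  then show ?thesis
    using assms by (auto simp: relabel_flat_eq_vimage)
qed

lemma relabel_flat_comp:
  assumes V: "finite V" and X: "X \<subseteq> coord_space V"
  shows "relabel_flat V (\<tau> \<circ> \<sigma>) X = relabel_flat (\<sigma> ` V) \<tau> (relabel_flat V \<sigma> X)"
proof -
  have W: "finite (\<sigma> ` V)" and Y: "relabel_flat V \<sigma> X \<subseteq> coord_space (\<sigma> ` V)"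
    using V by (auto simp: relabel_flat_def)
  have "pull_back V \<sigma> (pull_back (\<sigma> ` V) \<tau> y) = pull_back V (\<tau> \<circ> \<sigma>) y" for y
    by (rule poly_mapping_eqI) (use V in \<open>simp add: lookup_pull_back\<close>)
  then show ?thesis
    using pull_back_in_coord_space[OF W]
    by (simp add: relabel_flat_eq_vimage[OF V X] relabel_flat_eq_vimage[OF W Y[unfolded
      relabel_flat_eq_vimage[OF V X]]] image_comp)
qed

lemma relabel_flat_cong:
  assumes "\<And>v. v \<in> V \<Longrightarrow> \<sigma> v = \<tau> v"
  shows "relabel_flat V \<sigma> X = relabel_flat V \<tau> X"
proof -
  have "\<sigma> ` V = \<tau> ` V"
    using assms by (rule image_cong[OF refl])
  then show ?thesis
    using assms by (simp add: relabel_flat_def)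
qed

lemma is_lspecies_shi_flats_dim: "is_lspecies (shi_flats_dim m k :: ('a, _) lspecies)"
  and is_lspecies_shi_flats: "is_lspecies (shi_flats m :: ('a, _) lspecies)"
proof -
  have fin: "finite (flats V (shi_arrangement m V r))" if "fin_linorder V r" for V :: "'a set" and r
    using that by (auto simp: fin_linorder_def intro: finite_flats finite_shi_arrangement)
  have bij: "finite V" "inj_on \<sigma> V" "\<sigma> ` V = W" if "order_bij V r W s \<sigma>"
    for V W :: "'a set" and r s \<sigma>
    using that by (auto simp: order_bij_def fin_linorder_def bij_betw_def)
  have dim: "flat_dim (relabel_flat V \<sigma> X) = flat_dim X"
    if "order_bij V r W s \<sigma>" "X \<in> flats V (shi_arrangement m V r)" for V W :: "'a set" and r s \<sigma> X
    using flat_dim_relabel_flat[OF bij(1,2)[OF that(1)] flats_subset_coord_space[OF that(2)]] .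
  have id: "relabel_flat V id X = X"
    if "fin_linorder V r" "X \<in> flats V (shi_arrangement m V r)" for V :: "'a set" and r X
    using that relabel_flat_id flats_subset_coord_space by (metis fin_linorder_def)
  have comp: "relabel_flat V (\<tau> \<circ> \<sigma>) X = relabel_flat W \<tau> (relabel_flat V \<sigma> X)"
    if "order_bij V r W s \<sigma>" "X \<in> flats V (shi_arrangement m V r)"
    for V W :: "'a set" and r s \<sigma> \<tau> X
    using relabel_flat_comp[OF bij(1)[OF that(1)] flats_subset_coord_space[OF that(2)]]
      bij(3)[OF that(1)] by simp
  show "is_lspecies (shi_flats m :: ('a, ('a \<Rightarrow>\<^sub>0 real) set) lspecies)"
  proof (rule is_lspeciesI; simp only: shi_flats_def lspecies.simps)
    fix V r W s and \<sigma> \<tau> :: "'a \<Rightarrow> 'a" and X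
    assume "\<And>v. v \<in> V \<Longrightarrow> \<sigma> v = \<tau> v"
    then show "relabel_flat V \<sigma> X = relabel_flat V \<tau> X"
      by (rule relabel_flat_cong)
  qed (fact fin, erule (1) relabel_flat_in_flats, erule (1) id, erule (1) comp)
  show "is_lspecies (shi_flats_dim m k :: ('a, ('a \<Rightarrow>\<^sub>0 real) set) lspecies)"
  proof (rule is_lspeciesI; simp only: shi_flats_dim_def lspecies.simps mem_Collect_eq; (elim conjE)?)
    show "finite {X \<in> flats V (shi_arrangement m V r). flat_dim X = k}"
      if "fin_linorder V r" for V :: "'a set" and r
      using fin[OF that] by simp
  next
    fix V r W s and \<sigma> :: "'a \<Rightarrow> 'a" and X
    assume *: "order_bij V r W s \<sigma>" "X \<in> flats V (shi_arrangement m V r)" "flat_dim X = k"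
    show "relabel_flat V \<sigma> X \<in> flats W (shi_arrangement m W s) \<and>
        flat_dim (relabel_flat V \<sigma> X) = k"
      using relabel_flat_in_flats[OF *(1,2)] dim[OF *(1,2)] *(3) by simp
  next
    fix V r W s and \<sigma> \<tau> :: "'a \<Rightarrow> 'a" and X
    assume "\<And>v. v \<in> V \<Longrightarrow> \<sigma> v = \<tau> v"
    then show "relabel_flat V \<sigma> X = relabel_flat V \<tau> X"
      by (rule relabel_flat_cong)
  qed (erule (1) id comp)+
qed


section \<open>Flats as partitions into connected configurations\<close>

definition shi_hyperplane :: "'a set \<Rightarrow> 'a \<Rightarrow> 'a \<Rightarrow> int \<Rightarrow> ('a \<Rightarrow>\<^sub>0 real) set"
  where "shi_hyperplane V u v a =
    {x \<in> coord_space V. Poly_Mapping.lookup x u - Poly_Mapping.lookup x v = of_int a}"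

lemma shi_arrangement_iff:
  assumes "fin_linorder V r"
  shows "H \<in> shi_arrangement m V r \<longleftrightarrow>
    (\<exists>u v a. H = shi_hyperplane V u v a \<and> u \<in> V \<and> v \<in> V \<and> lt_of r u v \<and> a \<in> {1 - int m..int m})"
  unfolding shi_arrangement_def shi_hyperplane_def lt_of_def by auto

text \<open>
  The flat on which the coordinates in each block \<open>B\<close> are a translate of \<open>c B\<close>.
\<close>

definition flat_of :: "'a set \<Rightarrow> 'a set set \<Rightarrow> ('a set \<Rightarrow> 'a \<Rightarrow> int) \<Rightarrow> ('a \<Rightarrow>\<^sub>0 real) set"
  where "flat_of V P c = {x \<in> coord_space V. \<forall>B\<in>P. \<forall>u\<in>B. \<forall>v\<in>B.
    Poly_Mapping.lookup x u - Poly_Mapping.lookup x v = of_int (c B u - c B v)}"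

definition block_of :: "'a set set \<Rightarrow> 'a \<Rightarrow> 'a set"
  where "block_of P u = (THE B. B \<in> P \<and> u \<in> B)"

lemma block_of_eq:
  assumes "partition_on V P" "B \<in> P" "u \<in> B"
  shows "block_of P u = B"
  unfolding block_of_def
proof (rule the_equality)
  fix C assume "C \<in> P \<and> u \<in> C"
  then show "C = B"
    using assms partition_onD2[OF assms(1)] by (auto simp: disjoint_def)
qed (use assms in blast)

lemma block_of:
  assumes "partition_on V P" "u \<in> V"
  shows "block_of P u \<in> P" "u \<in> block_of P u"
proof -
  obtain B where "B \<in> P" "u \<in> B"
    using assms partition_onD1 by blast
  then show "block_of P u \<in> P" "u \<in> block_of P u"
    using block_of_eq[OF assms(1)] by simp_all
qed

text \<open>
  The point of the flat with the block \<open>B\<close> translated by \<open>t B\<close>. Translating one block and not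
  another shows that the differences between blocks are not fixed.
\<close>

definition flat_point ::
    "'a set \<Rightarrow> 'a set set \<Rightarrow> ('a set \<Rightarrow> 'a \<Rightarrow> int) \<Rightarrow> ('a set \<Rightarrow> real) \<Rightarrow> ('a \<Rightarrow>\<^sub>0 real)"
  where "flat_point V P c t = vec_on V (\<lambda>u. of_int (c (block_of P u) u) + t (block_of P u))"

lemma lookup_flat_point:
  assumes "finite V" "partition_on V P" "B \<in> P" "u \<in> B"
  shows "Poly_Mapping.lookup (flat_point V P c t) u = of_int (c B u) + t B"
  using assms finite_partition_on(4)[OF assms(1-3)] block_of_eq[OF assms(2-4)]
  by (auto simp: flat_point_def lookup_vec_on)

lemma flat_point_in_flat_of:
  assumes "finite V" "partition_on V P"
  shows "flat_point V P c t \<in> flat_of V P c"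
  using assms lookup_flat_point[OF assms]
  by (simp add: flat_of_def flat_point_def vec_on_in_coord_space[OF assms(1)])

text \<open>The directions of the flat are the vectors that are constant on each block.\<close>

lemma flat_dim_flat_of:
  assumes V: "finite V" and P: "partition_on V P"
  shows "flat_dim (flat_of V P c) = card P"
proof -
  note fin = finite_partition_on[OF V P]
  define ind where "ind B = vec_on V (\<lambda>u. of_bool (u \<in> B))" for B
  have ind: "Poly_Mapping.lookup (ind B) u = of_bool (B = C)" if "B \<in> P" "C \<in> P" "u \<in> C" for B C u
  proof -
    have "u \<in> V"
      using fin(4)[OF that(2)] that(3) by blast
    moreover have "u \<in> B \<longleftrightarrow> B = C"
      using block_of_eq[OF P] that by metis
    ultimately show ?thesis
      by (simp add: ind_def lookup_vec_on[OF V])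
  qed
  have sum_ind: "Poly_Mapping.lookup (\<Sum>B\<in>P. a B *\<^sub>R ind B) u = a C" if "C \<in> P" "u \<in> C" for a C u
  proof -
    have "Poly_Mapping.lookup (\<Sum>B\<in>P. a B *\<^sub>R ind B) u = (\<Sum>B\<in>P. if B = C then a B else 0)"
      unfolding lookup_sum lookup_scaleR using ind[OF _ that] by (intro sum.cong refl) simp
    also have "\<dots> = a C"
      using fin(1) that(1) by simp
    finally show ?thesis .
  qed
  have inj: "inj_on ind P"
  proof (rule inj_onI)
    fix B C assume BC: "B \<in> P" "C \<in> P" "ind B = ind C"
    obtain u where "u \<in> C"
      using fin(3)[OF BC(2)] by blast
    then show "B = C"
      using ind[OF BC(1,2)] ind[OF BC(2,2)] BC(3) by simp
  qed
  let ?D = "{x - y | x y. x \<in> flat_of V P c \<and> y \<in> flat_of V P c}"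
  show ?thesis
    unfolding flat_dim_def
  proof (rule dim_unique[of "ind ` P"])
    show "ind ` P \<subseteq> ?D"
    proof
      fix z assume "z \<in> ind ` P"
      then obtain B where B: "B \<in> P" "z = ind B" by blast
      have "z = flat_point V P c (\<lambda>C. of_bool (B = C)) - flat_point V P c (\<lambda>C. 0)"
      proof (rule poly_mapping_eqI)
        fix u
        show "Poly_Mapping.lookup z u = Poly_Mapping.lookup
            (flat_point V P c (\<lambda>C. of_bool (B = C)) - flat_point V P c (\<lambda>C. 0)) u"
        proof (cases "u \<in> V")
          case True
          note u = block_of[OF P True]
          show ?thesis
            unfolding lookup_minus lookup_flat_point[OF V P u] B(2) ind[OF B(1) u] by simp
        qed (simp add: lookup_minus flat_point_def lookup_vec_on[OF V] B(2) ind_def)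
      qed
      then show "z \<in> ?D"
        using flat_point_in_flat_of[OF V P] by blast
    qed
    show "?D \<subseteq> span (ind ` P)"
    proof
      fix z assume "z \<in> ?D"
      then obtain x y where z: "z = x - y" and xy: "x \<in> flat_of V P c" "y \<in> flat_of V P c" by blast
      define a where "a B = Poly_Mapping.lookup z (SOME u. u \<in> B)" for B
      have "z = (\<Sum>B\<in>P. a B *\<^sub>R ind B)"
      proof (rule poly_mapping_eqI)
        fix u
        show "Poly_Mapping.lookup z u = Poly_Mapping.lookup (\<Sum>B\<in>P. a B *\<^sub>R ind B) u"
        proof (cases "u \<in> V")
          case True
          note u = block_of[OF P True]
          define v where "v = (SOME v. v \<in> block_of P u)"
          have v: "v \<in> block_of P u"
            unfolding v_def using u(2) by (rule someI)
          have diff: "Poly_Mapping.lookup w u - Poly_Mapping.lookup w v =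
              of_int (c (block_of P u) u - c (block_of P u) v)" if "w \<in> flat_of V P c" for w
            using that u v unfolding flat_of_def by blast
          have "Poly_Mapping.lookup z u = Poly_Mapping.lookup z v"
            using diff[OF xy(1)] diff[OF xy(2)] by (simp add: z lookup_minus)
          then show ?thesis
            unfolding sum_ind[OF u] by (simp add: a_def v_def)
        next
          case False
          then have "Poly_Mapping.lookup z u = 0"
            using xy by (simp add: z lookup_minus flat_of_def coord_space_iff)
          moreover have "Poly_Mapping.lookup (\<Sum>B\<in>P. a B *\<^sub>R ind B) u = 0"
            unfolding lookup_sum lookup_scaleR using False by (simp add: ind_def lookup_vec_on[OF V])
          ultimately show ?thesis by simp
        qed
      qed
      then show "z \<in> span (ind ` P)"
        by (simp add: span_sum span_scale span_base)
    qed
    show "independent (ind ` P)"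
    proof (rule independent_if_scalars_zero)
      show "finite (ind ` P)"
        using fin(1) by simp
      fix f x
      assume sum: "(\<Sum>x\<in>ind ` P. f x *\<^sub>R x) = 0" and "x \<in> ind ` P"
      then obtain B where B: "B \<in> P" "x = ind B" by blast
      obtain u where u: "u \<in> B"
        using fin(3)[OF B(1)] by blast
      have "(\<Sum>C\<in>P. f (ind C) *\<^sub>R ind C) = 0"
        using sum by (simp add: sum.reindex[OF inj])
      then show "f x = 0"
        using sum_ind[OF B(1) u, of "\<lambda>C. f (ind C)"] B(2) by simp
    qed
    show "card (ind ` P) = card P"
      using inj by (rule card_image)
  qed
qed

text \<open>
  It suffices to intersect the hyperplanes given by the edges inside the blocks: since the
  configurations are connected, the differences along edges determine all differences in a block.
\<close>

lemma flat_of_in_flats: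
  assumes V: "fin_linorder V r" and P: "partition_on V P"
    and c: "c \<in> (\<Pi>\<^sub>E B\<in>P. connected_configs m r B)"
  shows "flat_of V P c \<in> flats V (shi_arrangement m V r)"
proof -
  have finV: "finite V"
    using V by (simp add: fin_linorder_def)
  note fin = finite_partition_on[OF finV P]
  define \<H> where "\<H> = {shi_hyperplane V u v (c B u - c B v) | B u v.
    B \<in> P \<and> u \<in> B \<and> v \<in> B \<and> lt_of r u v \<and> c B u - c B v \<in> {1 - int m..int m}}"
  have "\<H> \<subseteq> shi_arrangement m V r"
  proof
    fix H assume "H \<in> \<H>"
    then obtain B u v where "B \<in> P" "u \<in> B" "v \<in> B" "lt_of r u v" "c B u - c B v \<in> {1 - int m..int m}"
      "H = shi_hyperplane V u v (c B u - c B v)"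
      unfolding \<H>_def by blast
    then show "H \<in> shi_arrangement m V r"
      unfolding shi_arrangement_iff[OF V] using fin(4) by blast
  qed
  moreover have "flat_of V P c = coord_space V \<inter> \<Inter>\<H>"
  proof
    show "flat_of V P c \<subseteq> coord_space V \<inter> \<Inter>\<H>"
      unfolding flat_of_def \<H>_def shi_hyperplane_def by blast
    show "coord_space V \<inter> \<Inter>\<H> \<subseteq> flat_of V P c"
    proof
      fix x assume x: "x \<in> coord_space V \<inter> \<Inter>\<H>"
      have "Poly_Mapping.lookup x u - Poly_Mapping.lookup x v = of_int (c B u - c B v)"
        if B: "B \<in> P" and uv: "u \<in> B" "v \<in> B" for B u v
      proof -
        let ?R = "{(a, b). a \<in> B \<and> b \<in> B \<and> shi_adj m r (c B) a b}"
        have lt: "Poly_Mapping.lookup x a - Poly_Mapping.lookup x b = of_int (c B a - c B b)"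
          if "a \<in> B" "b \<in> B" "lt_of r a b" "c B a - c B b \<in> {1 - int m..int m}" for a b
        proof -
          have "shi_hyperplane V a b (c B a - c B b) \<in> \<H>"
            unfolding \<H>_def using B that by blast
          then show ?thesis
            using x unfolding shi_hyperplane_def by blast
        qed
        have edge: "Poly_Mapping.lookup x a - Poly_Mapping.lookup x b = of_int (c B a - c B b)"
          if "(a, b) \<in> ?R" for a b
          using that lt[of a b] lt[of b a] unfolding shi_adj_def by force
        have "(u, v) \<in> ?R\<^sup>*"
          using PiE_mem[OF c B] uv by (simp add: connected_configs_def)
        then show ?thesis
        proof (induction rule: rtrancl_induct)
          case (step a b)
          then show ?case using edge[of a b] by simp
        qed simp
      qed
      then show "x \<in> flat_of V P c"
        using x by (simp add: flat_of_def)
    qed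
  qed
  moreover have "flat_of V P c \<noteq> {}"
    using flat_point_in_flat_of[OF finV P] by blast
  ultimately show ?thesis
    unfolding flats_def by blast
qed

text \<open>
  Two coordinates are in the same block precisely if their difference is constant on the flat;
  the constant differences then determine the configuration on each block up to translation.
\<close>

lemma flat_of_inj:
  assumes V: "fin_linorder V r"
    and P: "partition_on V P" and c: "c \<in> (\<Pi>\<^sub>E B\<in>P. connected_configs m r B)"
    and Q: "partition_on V Q" and d: "d \<in> (\<Pi>\<^sub>E B\<in>Q. connected_configs m r B)"
    and eq: "flat_of V P c = flat_of V Q d"
  shows "P = Q" "c = d"
proof -
  have finV: "finite V"
    using V by (simp add: fin_linorder_def)
  have same_block: "{(u, v). \<exists>B\<in>P. u \<in> B \<and> v \<in> B} = {(u, v). u \<in> V \<and> v \<in> V \<and>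
      (\<forall>x\<in>flat_of V P c. \<forall>y\<in>flat_of V P c. Poly_Mapping.lookup x u - Poly_Mapping.lookup x v =
        Poly_Mapping.lookup y u - Poly_Mapping.lookup y v)}"
    (is "?L = ?R") if P: "partition_on V P" for P and c :: "'a set \<Rightarrow> 'a \<Rightarrow> int"
  proof (intro equalityI subsetI; clarify)
    fix u v B assume *: "B \<in> P" "u \<in> B" "v \<in> B"
    then have "u \<in> V" "v \<in> V"
      using finite_partition_on(4)[OF finV P] by blast+
    moreover have "Poly_Mapping.lookup x u - Poly_Mapping.lookup x v = of_int (c B u - c B v)"
      if "x \<in> flat_of V P c" for x
      using that * unfolding flat_of_def by blast
    ultimately show "u \<in> V \<and> v \<in> V \<and>
      (\<forall>x\<in>flat_of V P c. \<forall>y\<in>flat_of V P c. Poly_Mapping.lookup x u - Poly_Mapping.lookup x v =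
        Poly_Mapping.lookup y u - Poly_Mapping.lookup y v)" by metis
  next
    fix u v
    assume uv: "u \<in> V" "v \<in> V" and const: "\<forall>x\<in>flat_of V P c. \<forall>y\<in>flat_of V P c.
        Poly_Mapping.lookup x u - Poly_Mapping.lookup x v =
        Poly_Mapping.lookup y u - Poly_Mapping.lookup y v"
    \<comment> \<open>If \<open>u\<close> and \<open>v\<close> were in different blocks, moving the block of \<open>u\<close> would change the difference.\<close>
    let ?p = "flat_point V P c"
    define t where "t C = (of_bool (C = block_of P u) :: real)" for C
    have "Poly_Mapping.lookup (?p t) u - Poly_Mapping.lookup (?p t) v =
        Poly_Mapping.lookup (?p (\<lambda>_. 0)) u - Poly_Mapping.lookup (?p (\<lambda>_. 0)) v"
      using const flat_point_in_flat_of[OF finV P] by blast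
    then have "t (block_of P u) = t (block_of P v)"
      unfolding lookup_flat_point[OF finV P block_of[OF P uv(1)]]
        lookup_flat_point[OF finV P block_of[OF P uv(2)]] by simp
    then have "block_of P v = block_of P u"
      by (simp add: t_def)
    then show "\<exists>B\<in>P. u \<in> B \<and> v \<in> B"
      using block_of[OF P uv(1)] block_of[OF P uv(2)] by auto
  qed
  have "{(u, v). \<exists>B\<in>P. u \<in> B \<and> v \<in> B} = {(u, v). \<exists>B\<in>Q. u \<in> B \<and> v \<in> B}"
    unfolding same_block[OF P, of c] same_block[OF Q, of d] eq ..
  then have "V // {(u, v). \<exists>B\<in>P. u \<in> B \<and> v \<in> B} = V // {(u, v). \<exists>B\<in>Q. u \<in> B \<and> v \<in> B}"
    by (rule arg_cong)
  then show "P = Q"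
    unfolding partition_on_eq_quotient[OF P] partition_on_eq_quotient[OF Q] .
  show "c = d"
  proof (rule PiE_ext[OF c])
    show "d \<in> (\<Pi>\<^sub>E B\<in>P. connected_configs m r B)"
      using d \<open>P = Q\<close> by simp
    fix B assume B: "B \<in> P"
    have cB: "c B \<in> connected_configs m r B" and dB: "d B \<in> connected_configs m r B"
      using PiE_mem[OF c B] PiE_mem[OF d, of B] B \<open>P = Q\<close> by simp_all
    have diff: "c B u - c B v = d B u - d B v" if uv: "u \<in> B" "v \<in> B" for u v
    proof -
      let ?x = "flat_point V P c (\<lambda>_. 0)"
      have x: "?x \<in> flat_of V P c" "?x \<in> flat_of V Q d"
        using flat_point_in_flat_of[OF finV P] eq by auto
      have "Poly_Mapping.lookup ?x u - Poly_Mapping.lookup ?x v = of_int (c B u - c B v)"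
        using x(1) B uv unfolding flat_of_def by blast
      moreover have "Poly_Mapping.lookup ?x u - Poly_Mapping.lookup ?x v = of_int (d B u - d B v)"
        using x(2) B uv \<open>P = Q\<close> unfolding flat_of_def by blast
      ultimately show ?thesis
        by (simp only: of_int_eq_iff)
    qed
    obtain u0 where u0: "u0 \<in> B" "c B u0 = 0"
      using cB by (auto simp: connected_configs_def)
    obtain v0 where v0: "v0 \<in> B" "d B v0 = 0"
      using dB by (auto simp: connected_configs_def)
    have "c B v0 \<ge> 0" "d B u0 \<ge> 0"
      using cB dB u0 v0 by (auto simp: connected_configs_def PiE_iff)
    then have "d B u0 = 0"
      using diff[OF u0(1) v0(1)] u0(2) v0(2) by linarith
    show "c B = d B"
    proof (rule PiE_ext[of _ B "\<lambda>_. {0..}"])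
      show "c B \<in> B \<rightarrow>\<^sub>E {0..}" "d B \<in> B \<rightarrow>\<^sub>E {0..}"
        using cB dB by (simp_all add: connected_configs_def)
      fix u assume "u \<in> B"
      then show "c B u = d B u"
        using diff[of u u0] u0 \<open>d B u0 = 0\<close> by simp
    qed
  qed
qed

text \<open>
  The blocks are the connected components of the graph formed by the hyperplanes through the
  flat, and the configuration on a block is read off from any point of the flat.
\<close>

lemma flats_eq_flat_of:
  assumes V: "fin_linorder V r" and X: "X \<in> flats V (shi_arrangement m V r)"
  shows "\<exists>P c. partition_on V P \<and> c \<in> (\<Pi>\<^sub>E B\<in>P. connected_configs m r B) \<and> X = flat_of V P c"
proof -
  have finV: "finite V"
    using V by (simp add: fin_linorder_def)
  obtain \<H> where H: "\<H> \<subseteq> shi_arrangement m V r" "X = coord_space V \<inter> \<Inter>\<H>"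
    using X unfolding flats_def by blast
  obtain x0 where x0: "x0 \<in> X"
    using X by (auto simp: flats_def)
  define x where "x = Poly_Mapping.lookup x0"
  define E where "E = {(u, v). u \<in> V \<and> v \<in> V \<and> (\<exists>a. a \<in> {1 - int m..int m} \<and>
    (lt_of r u v \<and> shi_hyperplane V u v a \<in> \<H> \<or> lt_of r v u \<and> shi_hyperplane V v u a \<in> \<H>))}"
  have "sym E"
    unfolding E_def sym_def by blast
  define S where "S = E\<^sup>* \<inter> V \<times> V"
  have "equiv V S"
    using \<open>sym E\<close> by (auto simp: S_def equiv_def refl_on_def intro!: symI transI
        dest: sym_rtrancl symD intro: rtrancl_trans)
  define P where "P = V // S"
  have P: "partition_on V P"
    unfolding P_def using \<open>equiv V S\<close> by (rule partition_on_quotient)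
  note fin = finite_partition_on[OF finV P]
  have S_iff: "(u, v) \<in> S" if "B \<in> P" "u \<in> B" "v \<in> B" for B u v
    using that \<open>equiv V S\<close> quotient_eqI[of V S B B u v] unfolding P_def
    by (meson in_quotient_imp_closed quotient_eq_iff)
  have P_closed: "v \<in> B" if "B \<in> P" "u \<in> B" "(u, v) \<in> S" for B u v
    using that \<open>equiv V S\<close> unfolding P_def by (rule in_quotient_imp_closed[rotated])
  \<comment> \<open>Along an edge the difference of coordinates is the same integer at all points of the flat.\<close>
  have edge: "y u - y v = x u - x v \<and> x u - x v \<in> \<int> \<and>
      (lt_of r u v \<and> x u - x v \<in> {1 - real m..real m} \<or> lt_of r v u \<and> x v - x u \<in> {1 - real m..real m})"
    if uv: "(u, v) \<in> E" and "z \<in> X" and y: "y = Poly_Mapping.lookup z" for u v y z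
  proof -
    obtain a where a: "a \<in> {1 - int m..int m}" and
      "lt_of r u v \<and> shi_hyperplane V u v a \<in> \<H> \<or> lt_of r v u \<and> shi_hyperplane V v u a \<in> \<H>"
      using uv unfolding E_def by blast
    then have "lt_of r u v \<and> x u - x v = of_int a \<and> y u - y v = of_int a \<or>
        lt_of r v u \<and> x v - x u = of_int a \<and> y v - y u = of_int a"
      using x0 \<open>z \<in> X\<close> unfolding x_def y H(2) shi_hyperplane_def by blast
    moreover have "real_of_int a \<in> {1 - real m..real m}"
      using a by auto
    moreover have "x u - x v \<in> \<int>" if "x v - x u = of_int a"
    proof -
      have "x u - x v = of_int (- a)" using that by simp
      then show ?thesis by (metis Ints_of_int)
    qed
    ultimately show ?thesis
      by force
  qed
  have path: "y u - y v = x u - x v \<and> x u - x v \<in> \<int>"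
    if "(u, v) \<in> E\<^sup>*" and z: "z \<in> X" "y = Poly_Mapping.lookup z" for u v y z
    using that(1)
  proof (induction rule: rtrancl_induct)
    case (step a b)
    have "y a - y b = x a - x b" "x a - x b \<in> \<int>"
      using edge[OF step.hyps(2) z] by blast+
    moreover have "x u - x b = (x u - x a) + (x a - x b)" by simp
    ultimately show ?case
      using step.IH by (metis Ints_add add_diff_cancel_right' diff_add_cancel diff_diff_eq2)
  qed simp
  define low where "low B = Min (x ` B)" for B
  define c where "c = (\<lambda>B\<in>P. \<lambda>u\<in>B. \<lfloor>x u - low B\<rfloor>)"
  have low: "low B \<in> x ` B" "u \<in> B \<Longrightarrow> low B \<le> x u" if "B \<in> P" for B u
    using fin(2,3)[OF that] by (simp_all add: low_def Min_in)
  have c: "real_of_int (c B u) = x u - low B" if B: "B \<in> P" "u \<in> B" for B u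
  proof -
    obtain v where v: "v \<in> B" "low B = x v"
      using low(1)[OF B(1)] by blast
    have "x u - x v \<in> \<int>"
      using path[of u v x0 x] S_iff[OF B v(1)] x0 by (simp add: S_def x_def)
    then show ?thesis
      using B v(2) by (simp add: c_def)
  qed
  have c_diff: "real_of_int (c B u - c B v) = x u - x v" if "B \<in> P" "u \<in> B" "v \<in> B" for B u v
    using c[OF that(1,2)] c[OF that(1,3)] by simp
  have "c \<in> (\<Pi>\<^sub>E B\<in>P. connected_configs m r B)"
  proof (rule PiE_I)
    fix B assume B: "B \<in> P"
    let ?R = "{(a, b). a \<in> B \<and> b \<in> B \<and> shi_adj m r (c B) a b}"
    have "c B u \<ge> 0" if "u \<in> B" for u
      using c[OF B that] low(2)[OF B that] by linarith
    then have "c B \<in> B \<rightarrow>\<^sub>E {0..}"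
      using B by (auto simp: c_def)
    moreover have "0 \<in> c B ` B"
    proof -
      obtain v where v: "v \<in> B" "low B = x v"
        using low(1)[OF B] by blast
      then have "c B v = 0"
        using c[OF B v(1)] by simp
      then show ?thesis using v(1) by (metis imageI)
    qed
    moreover have "(u, v) \<in> ?R\<^sup>*" if uv: "u \<in> B" "v \<in> B" for u v
    proof -
      have adj: "shi_adj m r (c B) a b" if "(a, b) \<in> E" "a \<in> B" "b \<in> B" for a b
      proof -
        have "lt_of r a b \<and> x a - x b \<in> {1 - real m..real m} \<or>
            lt_of r b a \<and> x b - x a \<in> {1 - real m..real m}"
          using edge[OF that(1) x0 x_def] by blast
        then have "lt_of r a b \<and> real_of_int (c B a - c B b) \<in> {1 - real m..real m} \<or>
            lt_of r b a \<and> real_of_int (c B b - c B a) \<in> {1 - real m..real m}"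
          unfolding c_diff[OF B that(2,3)] c_diff[OF B that(3,2)] .
        then show ?thesis
          unfolding shi_adj_def atLeastAtMost_iff by linarith
      qed
      have "(u, v) \<in> E\<^sup>*"
        using S_iff[OF B uv] by (simp add: S_def)
      then have "v \<in> B \<and> (u, v) \<in> ?R\<^sup>*"
      proof (induction rule: rtrancl_induct)
        case (step a b)
        then have "a \<in> B" "a \<in> V" "b \<in> V"
          using fin(4)[OF B] by (auto simp: E_def)
        then have "b \<in> B"
          using P_closed[OF B, of a b] step.hyps(2) by (simp add: S_def r_into_rtrancl)
        then have "(a, b) \<in> ?R"
          using adj[OF step.hyps(2)] \<open>a \<in> B\<close> by simp
        then show ?case
          using step.IH \<open>b \<in> B\<close> by (meson rtrancl.rtrancl_into_rtrancl)
      qed (use uv in simp)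
      then show ?thesis ..
    qed
    ultimately show "c B \<in> connected_configs m r B"
      unfolding connected_configs_def by blast
  qed (simp add: c_def)
  moreover have "X = flat_of V P c"
  proof
    show "X \<subseteq> flat_of V P c"
    proof
      fix z assume z: "z \<in> X"
      have "Poly_Mapping.lookup z u - Poly_Mapping.lookup z v = of_int (c B u - c B v)"
        if "B \<in> P" "u \<in> B" "v \<in> B" for B u v
        using path[of u v z, OF _ z refl] S_iff[OF that] c_diff[OF that] by (simp add: S_def)
      then show "z \<in> flat_of V P c"
        using z H(2) by (simp add: flat_of_def)
    qed
    show "flat_of V P c \<subseteq> X"
    proof
      fix z assume z: "z \<in> flat_of V P c"
      have "z \<in> H" if "H \<in> \<H>" for H
      proof -
        have "H \<in> shi_arrangement m V r"
          using that H(1) by blast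
        then obtain u v a where H': "H = shi_hyperplane V u v a" "u \<in> V" "v \<in> V" "lt_of r u v"
          "a \<in> {1 - int m..int m}"
          unfolding shi_arrangement_iff[OF V] by blast
        have "(u, v) \<in> E"
          unfolding E_def using H' that by blast
        then have "(u, v) \<in> S"
          using H' by (simp add: S_def r_into_rtrancl)
        obtain B where B: "B \<in> P" "u \<in> B"
          using H'(2) block_of[OF P] by blast
        have "v \<in> B"
          using P_closed[OF B \<open>(u, v) \<in> S\<close>] .
        have "x u - x v = of_int a"
          using x0 that H(2) unfolding H'(1) x_def shi_hyperplane_def by blast
        moreover have "Poly_Mapping.lookup z u - Poly_Mapping.lookup z v = of_int (c B u - c B v)"
          using z B \<open>v \<in> B\<close> unfolding flat_of_def by blast
        ultimately have "Poly_Mapping.lookup z u - Poly_Mapping.lookup z v = of_int a"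
          using c_diff[OF B \<open>v \<in> B\<close>] by simp
        then show ?thesis
          using z unfolding H'(1) shi_hyperplane_def flat_of_def by blast
      qed
      then show "z \<in> X"
        using z H(2) by (auto simp: flat_of_def)
    qed
  qed
  ultimately show ?thesis
    using P by blast
qed

text \<open>
  The set \<open>K\<close> of admitted dimensions covers both parts of the main theorem: it is \<open>{k}\<close> for the flats
  of dimension \<open>k\<close>, and the set of all natural numbers for all flats.
\<close>

theorem card_shi_flats:
  assumes V: "fin_linorder V r"
  shows "card {X \<in> flats V (shi_arrangement m V r). flat_dim X \<in> K} =
    (\<Sum>P | partition_on V P \<and> card P \<in> K. \<Prod>B\<in>P. fact (card B) * m ^ (card B - 1))"
proof -
  have finV: "finite V"
    using V by (simp add: fin_linorder_def)
  note fin = finite_partition_on[OF finV]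
  note dim = flat_dim_flat_of[OF finV]
  let ?D = "SIGMA P : {P. partition_on V P \<and> card P \<in> K}. \<Pi>\<^sub>E B\<in>P. connected_configs m r B"
  have inj: "inj_on (\<lambda>(P, c). flat_of V P c) ?D"
  proof (rule inj_onI)
    fix s t
    assume "s \<in> ?D" "t \<in> ?D" "(\<lambda>(P, c). flat_of V P c) s = (\<lambda>(P, c). flat_of V P c) t"
    moreover obtain P c Q d where "s = (P, c)" "t = (Q, d)"
      by (cases s, cases t) blast
    ultimately show "s = t"
      using flat_of_inj[OF V, of P c m Q d] by simp
  qed
  have image: "(\<lambda>(P, c). flat_of V P c) ` ?D =
    {X \<in> flats V (shi_arrangement m V r). flat_dim X \<in> K}"
  proof (intro equalityI subsetI)
    fix X assume "X \<in> (\<lambda>(P, c). flat_of V P c) ` ?D"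
    then obtain P c where *: "partition_on V P" "card P \<in> K"
      "c \<in> (\<Pi>\<^sub>E B\<in>P. connected_configs m r B)" "X = flat_of V P c" by auto
    then show "X \<in> {X \<in> flats V (shi_arrangement m V r). flat_dim X \<in> K}"
      using flat_of_in_flats[OF V *(1,3)] dim[OF *(1)] by simp
  next
    fix X assume X: "X \<in> {X \<in> flats V (shi_arrangement m V r). flat_dim X \<in> K}"
    then obtain P c where *: "partition_on V P"
      "c \<in> (\<Pi>\<^sub>E B\<in>P. connected_configs m r B)" "X = flat_of V P c"
      using flats_eq_flat_of[OF V] by blast
    with X have "card P \<in> K"
      using dim by simp
    then show "X \<in> (\<lambda>(P, c). flat_of V P c) ` ?D"
      using * by (intro image_eqI[of _ _ "(P, c)"]) simp_all
  qed
  have "card {X \<in> flats V (shi_arrangement m V r). flat_dim X \<in> K} = card ?D"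
    unfolding image[symmetric] using inj by (rule card_image)
  also have "\<dots> = (\<Sum>P | partition_on V P \<and> card P \<in> K. card (\<Pi>\<^sub>E B\<in>P. connected_configs m r B))"
  proof (rule card_SigmaI)
    show "finite {P. partition_on V P \<and> card P \<in> K}"
      using finitely_many_partition_on[OF finV] by (rule rev_finite_subset) blast
    show "\<forall>P\<in>{P. partition_on V P \<and> card P \<in> K}. finite (\<Pi>\<^sub>E B\<in>P. connected_configs m r B)"
      using fin(1,3,4) card_connected_configs(1)[OF V] by (intro ballI finite_PiE) auto
  qed
  also have "\<dots> = (\<Sum>P | partition_on V P \<and> card P \<in> K. \<Prod>B\<in>P. fact (card B) * m ^ (card B - 1))"
  proof (rule sum.cong[OF refl])
    fix P assume "P \<in> {P. partition_on V P \<and> card P \<in> K}"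
    then have P: "partition_on V P" by simp
    have "card (\<Pi>\<^sub>E B\<in>P. connected_configs m r B) = (\<Prod>B\<in>P. card (connected_configs m r B))"
      using fin(1)[OF P] by (rule card_PiE)
    also have "\<dots> = (\<Prod>B\<in>P. fact (card B) * m ^ (card B - 1))"
      using fin(3,4)[OF P] by (intro prod.cong refl card_connected_configs(2)[OF V]) blast+
    finally show "card (\<Pi>\<^sub>E B\<in>P. connected_configs m r B) =
      (\<Prod>B\<in>P. fact (card B) * m ^ (card B - 1))" .
  qed
  finally show ?thesis .
qed


section \<open>The isomorphisms\<close>

text \<open>
  The hypotheses on \<open>F\<close> hold for the species of sets of size \<open>k\<close> with \<open>K = {k}\<close>, and for the species of
  all sets with \<open>K = UNIV\<close>.
\<close>

lemma card_str_sets_of_lists: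
  assumes V: "finite V" and m: "m \<ge> 1"
    and F: "is_species F" "\<And>W. finite W \<Longrightarrow> card (str F W) = of_bool (card W \<in> K)"
  shows "card (str (F \<odot> iterated_subst (nonempty_part \<L>) m) V) =
    (\<Sum>P | partition_on V P \<and> card P \<in> K. \<Prod>B\<in>P. fact (card B) * m ^ (card B - 1))"
proof -
  let ?G = "iterated_subst (nonempty_part \<L>) m :: ('a univ, 'a univ) species"
  obtain n where n: "m = Suc n"
    using m by (cases m) auto
  have G: "is_species ?G"
    unfolding n by (intro is_species_iterated_subst is_species_nonempty_part is_species_list_species)
  have fin: "finite {P. partition_on V P}"
    using finitely_many_partition_on[OF V] .
  have "card (str (F \<odot> ?G) V) =
      (\<Sum>P | partition_on V P. card (str F (uset ` P)) * (\<Prod>B\<in>P. card (str ?G B)))"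
    by (rule card_str_subst[OF F(1) G V])
  also have "\<dots> = (\<Sum>P | partition_on V P.
      if card P \<in> K then \<Prod>B\<in>P. fact (card B) * m ^ (card B - 1) else 0)"
  proof (rule sum.cong[OF refl])
    fix P assume "P \<in> {P. partition_on V P}"
    then have P: "partition_on V P" by simp
    note finP = finite_partition_on[OF V P]
    have "card (uset ` P) = card P"
      using finP(2) by (intro card_image inj_onI) (simp add: uset_eq_iff)
    moreover have "(\<Prod>B\<in>P. card (str ?G B)) = (\<Prod>B\<in>P. fact (card B) * m ^ (card B - 1))"
      unfolding n using finP(2,3) by (intro prod.cong refl card_iterated_lists)
    ultimately show "card (str F (uset ` P)) * (\<Prod>B\<in>P. card (str ?G B)) =
        (if card P \<in> K then \<Prod>B\<in>P. fact (card B) * m ^ (card B - 1) else 0)"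
      using F(2)[of "uset ` P"] finP(1) by simp
  qed
  also have "\<dots> = (\<Sum>P | partition_on V P \<and> card P \<in> K. \<Prod>B\<in>P. fact (card B) * m ^ (card B - 1))"
    by (simp only: sum.inter_filter[OF fin, symmetric] mem_Collect_eq)
  finally show ?thesis .
qed

theorem theorem1p13:
  fixes m k :: nat
  assumes "m \<ge> 1"
  shows "(shi_flats_dim m k :: ('a univ, ('a univ \<Rightarrow>\<^sub>0 real) set) lspecies)
           \<cong>\<^sub>L forget_order (restrict_card \<E> k \<odot> iterated_subst (nonempty_part \<L>) m)
       \<and> (shi_flats m :: ('a univ, ('a univ \<Rightarrow>\<^sub>0 real) set) lspecies)
           \<cong>\<^sub>L forget_order (\<E> \<odot> iterated_subst (nonempty_part \<L>) m)"
proof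
  let ?G = "iterated_subst (nonempty_part \<L>) m :: ('a univ, 'a univ) species"
  obtain n where n: "m = Suc n"
    using assms by (cases m) auto
  have G: "is_species ?G"
    unfolding n by (intro is_species_iterated_subst is_species_nonempty_part is_species_list_species)
  have E: "is_species (\<E> :: ('a univ, 'a univ) species)"
    "is_species (restrict_card \<E> k :: ('a univ, 'a univ) species)"
    by (intro is_species_restrict_card is_species_set_species)+
  have fin: "finite V" if "fin_linorder V r" for V :: "'a univ set" and r
    using that by (simp add: fin_linorder_def)
  show "(shi_flats_dim m k :: ('a univ, ('a univ \<Rightarrow>\<^sub>0 real) set) lspecies)
      \<cong>\<^sub>L forget_order (restrict_card \<E> k \<odot> ?G)"
  proof (rule lspecies_iso_if_equinumerous[OF is_lspecies_shi_flats_dim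
        is_lspecies_forget_order[OF is_species_subst[OF E(2) G]]])
    fix V :: "'a univ set" and r
    assume V: "fin_linorder V r"
    have "card (str (restrict_card \<E> k \<odot> ?G) V) =
        (\<Sum>P | partition_on V P \<and> card P \<in> {k}. \<Prod>B\<in>P. fact (card B) * m ^ (card B - 1))"
      by (rule card_str_sets_of_lists[OF fin[OF V] assms E(2)])
        (simp add: restrict_card_def set_species_def)
    then show "card (lstr (shi_flats_dim m k) V r) =
        card (lstr (forget_order (restrict_card \<E> k \<odot> ?G)) V r)"
      using card_shi_flats[OF V, of m "{k}"] by (simp add: shi_flats_dim_def forget_order_def)
  qed
  show "(shi_flats m :: ('a univ, ('a univ \<Rightarrow>\<^sub>0 real) set) lspecies)
      \<cong>\<^sub>L forget_order (\<E> \<odot> ?G)"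
  proof (rule lspecies_iso_if_equinumerous[OF is_lspecies_shi_flats
        is_lspecies_forget_order[OF is_species_subst[OF E(1) G]]])
    fix V :: "'a univ set" and r
    assume V: "fin_linorder V r"
    have "card (str (\<E> \<odot> ?G) V) =
        (\<Sum>P | partition_on V P \<and> card P \<in> UNIV. \<Prod>B\<in>P. fact (card B) * m ^ (card B - 1))"
      by (rule card_str_sets_of_lists[OF fin[OF V] assms E(1)]) (simp add: set_species_def)
    then show "card (lstr (shi_flats m) V r) = card (lstr (forget_order (\<E> \<odot> ?G)) V r)"
      using card_shi_flats[OF V, of m UNIV] by (simp add: shi_flats_def forget_order_def)
  qed
qed

end
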